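(* There exist $r\in(0,1)$, a $2\times2$ rotation matrix $R$ with $R^{n}\neq \mathrm{Id}$ for all integers $n\ge1$, a finite index set $I$, and vectors $a_i\in\mathbb{R}^2$ ($i\in I$) such that the homogeneous planar self-similar IFS $\{\varphi_{i}(x)=rRx+a_{i}\}_{i\in I}$ satisfies the strong separation condition, and the self-similar measure $\mu$ (the unique compactly supported Borel probability measure with $\mu=\sum_{i\in I}|I|^{-1}\cdot\varphi_{i}\mu$) satisfies $\dim\mu>1$, and each of the sets \[ \{u\in S\::\:P_{u}\mu\text{ is singular}\} \quad\text{and}\quad \{u\in S\::\:\mu_{u,x}\text{ is discrete for }\mu\text{-a.e. }x\in\mathbb{R}^{2}\} \] contains a dense $G_{\delta}$ subset of $S$.
   Context: $S$ is the unit circle of $\mathbb{R}^2$. For $u\in S$, $P_u$ denotes the orthogonal projection onto the line spanned by $u$, and $\varphi_i\mu$ denotes the pushforward of $\mu$ under $\varphi_i$. The strong separation condition means that the sets $\varphi_i(K)$, $i\in I$, are pairwise disjoint, where $K$ is the attractor of the IFS. For $u\in S$, $\{\mu_{u,x}\}_{x\in\mathbb{R}^2}$ is the disintegration of $\mu$ with respect to the $\sigma$-algebra $P_u^{-1}(\mathcal{B})$ ($\mathcal{B}$ the Borel $\sigma$-algebra): each $\mu_{u,x}$ is a Borel probability measure supported on $P_u^{-1}(P_u x)$, and for every bounded Borel $f$, $\int f\,d\mu_{u,x}=E_\mu(f\mid P_u^{-1}(\mathcal{B}))(x)$ for $\mu$-a.e. $x$. A measure is discrete if it is supported on a countable set.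 $\dim\mu$ denotes the (exact) dimension of $\mu$. *)

theory Defs
  imports "HOL-Analysis.Analysis" "HOL-Probability.Probability"
begin

type_synonym R2 = "real^2"

definition proj_line :: "R2 \<Rightarrow> R2 \<Rightarrow> R2" where
  "proj_line u x = (x \<bullet> u) *\<^sub>R u"

definition sim_map :: "real \<Rightarrow> real^2^2 \<Rightarrow> R2 \<Rightarrow> R2 \<Rightarrow> R2" where
  "sim_map r R a x = r *\<^sub>R (R *v x) + a"

definition SSC :: "real \<Rightarrow> real^2^2 \<Rightarrow> nat set \<Rightarrow> (nat \<Rightarrow> R2) \<Rightarrow> bool" where
  "SSC r R I a \<longleftrightarrow> (\<exists>K. compact K \<and> K \<noteq> {} \<and> K = (\<Union>i\<in>I. sim_map r R (a i) ` K) \<and>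
     (\<forall>i\<in>I. \<forall>j\<in>I. i \<noteq> j \<longrightarrow> sim_map r R (a i) ` K \<inter> sim_map r R (a j) ` K = {}))"

definition self_similar_measure ::
  "real \<Rightarrow> real^2^2 \<Rightarrow> nat set \<Rightarrow> (nat \<Rightarrow> R2) \<Rightarrow> R2 measure \<Rightarrow> bool" where
  "self_similar_measure r R I a \<mu> \<longleftrightarrow>
     sets \<mu> = sets borel \<and> prob_space \<mu> \<and>
     (\<exists>K. compact K \<and> emeasure \<mu> (UNIV - K) = 0) \<and>
     (\<forall>A\<in>sets borel. emeasure \<mu> A =
        (\<Sum>i\<in>I. ennreal (1 / real (card I)) * emeasure (distr \<mu> borel (sim_map r R (a i))) A))"

definition exact_dim :: "R2 measure \<Rightarrow> real \<Rightarrow> bool" where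
  "exact_dim \<mu> d \<longleftrightarrow>
     (AE x in \<mu>. ((\<lambda>\<rho>. ln (measure \<mu> (ball x \<rho>)) / ln \<rho>) \<longlongrightarrow> d) (at_right 0))"

definition proj_singular :: "R2 measure \<Rightarrow> R2 \<Rightarrow> bool" where
  "proj_singular \<mu> u \<longleftrightarrow> (\<exists>A\<in>sets borel.
     emeasure (distr \<mu> borel (proj_line u)) (UNIV - A) = 0 \<and>
     emeasure (distr lborel borel (\<lambda>t::real. t *\<^sub>R u)) A = 0)"

definition disintegration :: "R2 measure \<Rightarrow> R2 \<Rightarrow> (R2 \<Rightarrow> R2 measure) \<Rightarrow> bool" where
  "disintegration \<mu> u \<nu> \<longleftrightarrow>
     (\<forall>x. prob_space (\<nu> x) \<and> sets (\<nu> x) = sets borel \<and>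
          emeasure (\<nu> x) (UNIV - proj_line u -` {proj_line u x}) = 0) \<and>
     (\<forall>f::R2 \<Rightarrow> real. f \<in> borel_measurable borel \<and> bounded (range f) \<longrightarrow>
        (AE x in \<mu>. (\<integral>y. f y \<partial>(\<nu> x)) =
            real_cond_exp \<mu> (vimage_algebra UNIV (proj_line u) borel) f x))"

definition discrete_measure :: "R2 measure \<Rightarrow> bool" where
  "discrete_measure \<nu> \<longleftrightarrow> (\<exists>C. countable C \<and> emeasure \<nu> (UNIV - C) = 0)"

definition contains_dense_Gdelta :: "R2 set \<Rightarrow> R2 set \<Rightarrow> bool" where
  "contains_dense_Gdelta S X \<longleftrightarrow>
     (\<exists>G. G \<subseteq> X \<and> gdelta_in (top_of_set S) G \<and> S \<subseteq> closure G)"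

end

theory Submission
  imports Defs
begin

text \<open>
  Identify the plane with the complex numbers and let \<open>\<beta> = 8 + i\<close>. The maps are
  \<open>x \<mapsto> (d + x) / \<beta>\<close>, where \<open>d\<close> runs over the nine Gaussian integers with coordinates in
  \<open>{-1, 0, 1}\<close>. The dimension is \<open>ln 9 / ln \<bar>\<beta>\<bar> > 1\<close>, and since the attractor has diameter less
  than 1 while distinct digits are at distance at least 1, the pieces are separated.

  A point \<open>x\<close> with digit sequence \<open>\<omega>\<close> satisfies \<open>\<beta>^N x = \<pi>(shift^N \<omega>)\<close> modulo Gaussian integers,
  where \<open>\<pi>\<close> denotes the coding map. The directions of the vectors dual to \<open>\<beta>^N + 1/10\<close> are dense, so
  for generic \<open>u\<close> there are \<open>t_n\<close> and \<open>N_n\<close>, both tending to infinity, with \<open>t_n u\<close> within \<open>1/n\<close> of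
  that vector. Hence, modulo 1,
  \<open>t_n \<langle>u, x\<rangle> = Re (\<pi>(shift^{N_n} \<omega>)) + Re x / 10 + o(1)\<close>, and the right-hand side stays in an
  interval of length less than 1/2.

  Singularity: a set of reals \<open>s\<close> for which all \<open>t_n s\<close> avoid an interval of length more than 1/2 modulo 1
  is disjoint from its translates by \<open>1 / (2 t_n)\<close>, hence null by continuity of translation.

  Discreteness: by independence of the digits, almost surely
  \<open>liminf Re (\<pi>(shift^{N_n} \<omega>))\<close> equals the minimum \<open>m\<close> of \<open>Re\<close> on the attractor. So the liminf of
  \<open>t_n \<langle>u, x\<rangle>\<close> modulo 1 is \<open>m + Re x / 10\<close>, and \<open>\<langle>u, x\<rangle>\<close> determines \<open>x\<close> almost surely: the
  conditional measures are Dirac masses.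
\<close>

section \<open>Lebesgue null sets\<close>

text \<open>Continuity of translation: a compact \<open>C\<close> inside \<open>T\<close> of almost
  full measure and its translate by a small \<open>h n\<close> are disjoint, and both lie in an open
  \<open>U\<close> barely larger than \<open>T\<close>. So twice the measure of \<open>C\<close> is
  at most that of \<open>U\<close>.\<close>

lemma lborel_null_if_disjoint_translates:
  fixes T :: "real set" and h :: "nat \<Rightarrow> real"
  assumes T: "T \<in> sets borel" "bounded T" and h: "h \<longlonglongrightarrow> 0"
    and disj: "\<And>n s. s \<in> T \<Longrightarrow> s + h n \<notin> T"
  shows "emeasure lborel T = 0"
proof (rule ccontr)
  assume pos: "emeasure lborel T \<noteq> 0"
  have "emeasure lborel T < \<infinity>"
    using emeasure_bounded_finite[OF T(2)] .
  then obtain a where a: "emeasure lborel T = ennreal a" "a > 0"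
    using pos by (cases "emeasure lborel T") (auto simp: less_le)
  \<comment> \<open>With error \<open>a / 3\<close> on both sides, \<open>C\<close> has measure
    above 2a/3 and \<open>U\<close> below 4a/3, which contradicts the doubling.\<close>
  have a3: "a / 3 > 0" using a by simp
  have Tl: "T \<in> sets lebesgue" using T(1) by simp
  obtain U where U: "open U" "T \<subseteq> U" "emeasure lborel (U - T) < ennreal (a/3)"
    by (rule outer_regular_lborel[OF T(1) a3])
  obtain C where C: "closed C" "C \<subseteq> T" "emeasure lebesgue (T - C) < ennreal (a/3)"
    by (rule sets_lebesgue_inner_closed[OF Tl a3])
  have cC: "compact C"
    using C T(2) by (meson bounded_subset compact_eq_bounded_closed)
  have meas: "C \<in> sets lborel" "T \<in> sets lborel" "U \<in> sets lborel" "T - C \<in> sets lborel"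
    "U - T \<in> sets lborel"
    using C(1) T(1) U(1) by auto
  have TC: "emeasure lborel (T - C) < ennreal (a/3)"
    using C(3) emeasure_completion[of "T - C" lborel] meas by simp
  have mT: "emeasure lborel T \<le> emeasure lborel C + emeasure lborel (T - C)"
    using emeasure_subadditive[OF meas(1,4)] C(2) by (simp add: Un_absorb1)
  obtain d where d: "d > 0" "\<And>x t. x \<in> C \<Longrightarrow> \<bar>t\<bar> < d \<Longrightarrow> x + t \<in> U"
  proof -
    have "closed (- U)" "C \<inter> - U = {}" using U C(2) by auto
    then obtain d where d: "d > 0" "\<forall>x\<in>C. \<forall>y\<in>- U. d \<le> dist x y"
      using separate_compact_closed[OF cC] by blast
    have "x + t \<in> U" if "x \<in> C" "\<bar>t\<bar> < d" for x t
    proof (rule ccontr)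
      assume "x + t \<notin> U"
      then have "d \<le> dist x (x + t)" using d(2) that(1) by blast
      then show False using that(2) by (simp add: dist_real_def)
    qed
    then show thesis using that d(1) by blast
  qed
  obtain n where n: "\<bar>h n\<bar> < d"
    using LIMSEQ_D[OF h d(1)] by auto
  define D where "D = (+) (h n) ` C"
  have D: "D \<in> sets lborel"
    unfolding D_def sets_lborel
    by (rule borel_compact) (rule compact_continuous_image[OF _ cC], intro continuous_intros)
  have "emeasure lborel D = emeasure (distr lborel borel ((+) (h n))) D"
    by (simp add: lborel_distr_plus)
  also have "\<dots> = emeasure lborel ((+) (h n) -` D)"
    using D by (subst emeasure_distr) auto
  also have "(+) (h n) -` D = C" by (auto simp: D_def)
  finally have mD: "emeasure lborel D = emeasure lborel C" .
  have "C \<inter> D = {}"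
    using disj[of _ n] C(2) by (auto simp: D_def add.commute)
  then have "emeasure lborel C + emeasure lborel D = emeasure lborel (C \<union> D)"
    by (rule plus_emeasure[OF meas(1) D])
  also have "\<dots> \<le> emeasure lborel U"
    using d(2)[OF _ n] C(2) U(2) by (intro emeasure_mono meas) (auto simp: D_def add.commute)
  also have "\<dots> \<le> emeasure lborel T + emeasure lborel (U - T)"
    using emeasure_subadditive[OF meas(2,5)] U(2) by (simp add: Un_absorb1)
  finally have CU: "emeasure lborel C + emeasure lborel C \<le> emeasure lborel T + emeasure lborel (U - T)"
    by (simp add: mD)
  have "emeasure lborel C \<le> emeasure lborel T"
    by (rule emeasure_mono[OF C(2) meas(2)])
  then obtain c where c: "emeasure lborel C = ennreal c" "c \<ge> 0"
    using a(1) by (cases "emeasure lborel C") (auto simp: top_unique)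
  obtain e where e: "emeasure lborel (U - T) = ennreal e" "e \<ge> 0" "e < a/3"
    using U(3) a by (cases "emeasure lborel (U - T)") (auto simp: ennreal_less_iff)
  obtain f where f: "emeasure lborel (T - C) = ennreal f" "f \<ge> 0" "f < a/3"
    using TC a by (cases "emeasure lborel (T - C)") (auto simp: ennreal_less_iff)
  have "c + c \<le> a + e"
    using CU a(2) c(2) e(2) unfolding a(1) c(1) e(1) by (simp flip: ennreal_plus)
  moreover have "a \<le> c + f"
    using mT a(2) c(2) f(2) unfolding a(1) c(1) f(1) by (simp flip: ennreal_plus)
  ultimately show False using e f a by linarith
qed

lemma null_set_if_disjoint_translates:
  fixes S :: "real set" and h :: "nat \<Rightarrow> real"
  assumes S: "S \<in> sets borel" and h: "h \<longlonglongrightarrow> 0"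
    and disj: "\<And>n s. s \<in> S \<Longrightarrow> s + h n \<notin> S"
  shows "emeasure lborel S = 0"
proof -
  have "emeasure lborel (S \<inter> cball 0 r) = 0" for r
    using disj S by (intro lborel_null_if_disjoint_translates[OF _ _ h]) auto
  then have "S \<inter> cball 0 (real n) \<in> null_sets lborel" for n
    using S by (auto simp: null_sets_def)
  then have "(\<Union>n. S \<inter> cball 0 (real n)) \<in> null_sets lborel"
    by (intro null_sets_UN)
  moreover have "(\<Union>n. S \<inter> cball 0 (real n)) = S"
    by (auto simp: real_arch_simple)
  ultimately show ?thesis by (simp add: null_sets_def)
qed

text \<open>The representative of \<open>s\<close> modulo 1 in [-1/2, 1/2).\<close>

definition int_dev :: "real \<Rightarrow> real" where
  "int_dev s = s - of_int \<lfloor>s + 1/2\<rfloor>"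

lemma int_dev_eq: "\<bar>s\<bar> < 1/2 \<Longrightarrow> int_dev (of_int k + s) = s"
  unfolding int_dev_def by (simp add: floor_eq_iff, linarith)

lemma measurable_int_dev [measurable]: "int_dev \<in> borel_measurable borel"
  unfolding int_dev_def by measurable

text \<open>Translating \<open>s\<close> by 1 / (2 t k) changes the phase \<open>t k * s\<close> by
  1/2, while two phases in [-c, c] differ by at most 2c < 1/2 modulo 1. So the \<open>s\<close>
  whose phases stay small from index \<open>m\<close> on form a set disjoint from its translates;
  the union over \<open>m\<close> is countable.\<close>

lemma null_set_near_integers:
  fixes t :: "nat \<Rightarrow> real"
  assumes t: "filterlim t at_top sequentially" and c: "c < 1/4"
  shows "emeasure lborel {s. \<exists>m. \<forall>k\<ge>m. \<bar>int_dev (t k * s)\<bar> \<le> c} = 0"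
proof -
  have "{s. \<forall>k\<ge>m. \<bar>int_dev (t k * s)\<bar> \<le> c} \<in> null_sets lborel" for m
  proof -
    let ?S = "{s. \<forall>k\<ge>m. \<bar>int_dev (t k * s)\<bar> \<le> c}"
    \<comment> \<open>Starting where \<open>t k \<ge> 1\<close> keeps the translations 1 / (2 t k)
      away from division by zero.\<close>
    obtain m' where m': "m' \<ge> m" "\<And>k. k \<ge> m' \<Longrightarrow> t k \<ge> 1"
    proof -
      have "eventually (\<lambda>k. t k \<ge> 1) sequentially"
        using t by (auto simp: filterlim_at_top)
      then obtain m0 where "\<And>k. k \<ge> m0 \<Longrightarrow> t k \<ge> 1"
        by (auto simp: eventually_sequentially)
      then show thesis using that[of "max m m0"] by auto
    qed
    have S: "?S \<in> sets borel" by measurable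
    moreover have "(\<lambda>n. 1 / (2 * t (n + m'))) \<longlonglongrightarrow> 0"
    proof (rule tendsto_divide_0[OF tendsto_const])
      have "filterlim (\<lambda>n. t (n + m')) at_top sequentially"
        by (rule filterlim_compose[OF t]) (rule filterlim_add_const_nat_at_top)
      then have "filterlim (\<lambda>n. 2 * t (n + m')) at_top sequentially"
        by (intro filterlim_tendsto_pos_mult_at_top[OF tendsto_const]) auto
      then show "filterlim (\<lambda>n. 2 * t (n + m')) at_infinity sequentially"
        by (rule filterlim_at_top_imp_at_infinity)
    qed
    moreover have "s + 1 / (2 * t (n + m')) \<notin> ?S" if s: "s \<in> ?S" for n s
    proof
      assume s': "s + 1 / (2 * t (n + m')) \<in> ?S"
      let ?k = "n + m'"
      have k: "?k \<ge> m" "t ?k \<ge> 1" using m' by auto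
      have e: "t ?k * (s + 1 / (2 * t ?k)) = t ?k * s + 1/2"
        using k(2) by (simp add: field_simps)
      have b: "\<bar>int_dev (t ?k * s)\<bar> \<le> c" using s k by auto
      have b': "\<bar>int_dev (t ?k * s + 1/2)\<bar> \<le> c" using s' k e by force
      \<comment> \<open>The two rounded values differ by an integer that lies within 2c < 1/2 of
        1/2, hence strictly between 0 and 1.\<close>
      have "real_of_int (\<lfloor>t ?k * s + 1/2 + 1/2\<rfloor> - \<lfloor>t ?k * s + 1/2\<rfloor>) =
          1/2 + int_dev (t ?k * s) - int_dev (t ?k * s + 1/2)"
        unfolding int_dev_def by simp
      then obtain j :: int where "real_of_int j =
          1/2 + int_dev (t ?k * s) - int_dev (t ?k * s + 1/2)" by blast
      then have "real_of_int j > 0" "real_of_int j < 1" using b b' c by linarith+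
      then have "0 < j" "j < 1" by simp_all
      then show False by linarith
    qed
    ultimately have "emeasure lborel ?S = 0"
      by (rule null_set_if_disjoint_translates)
    then show ?thesis using S by (simp add: null_sets_def)
  qed
  then have "(\<Union>m. {s. \<forall>k\<ge>m. \<bar>int_dev (t k * s)\<bar> \<le> c}) \<in> null_sets lborel"
    by (intro null_sets_UN) auto
  moreover have "(\<Union>m. {s. \<forall>k\<ge>m. \<bar>int_dev (t k * s)\<bar> \<le> c}) =
    {s. \<exists>m. \<forall>k\<ge>m. \<bar>int_dev (t k * s)\<bar> \<le> c}" by auto
  ultimately show ?thesis by (simp add: null_sets_def)
qed

section \<open>The digit expansion in base $8+i$\<close>

text \<open>The modulus sqrt 65 is below 9, so nine digits give dimension above 1, yet large enough
  to keep the attractor in a disc of radius about 1/5.\<close>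

definition base :: complex where
  "base = Complex 8 1"

text \<open>Reducing modulo 3 makes every natural number a digit, so the coding map below needs no side
  condition on the digit sequence.\<close>

definition digit :: "nat \<Rightarrow> complex" where
  "digit i = Complex (real (i mod 3) - 1) (real (i div 3 mod 3) - 1)"

lemma cmod_base: "cmod base = sqrt 65"
  by (simp add: base_def cmod_def)

lemma cmod_base_ge: "cmod base \<ge> 806/100"
  unfolding cmod_base by (rule real_le_rsqrt) (simp add: power2_eq_square)

lemma base_nonzero [simp]: "base \<noteq> 0"
  by (simp add: base_def complex_eq_iff)

lemma inverse_base: "inverse base = Complex (8/65) (-1/65)"
  by (simp add: base_def complex_eq_iff power2_eq_square)

text \<open>Modulo 5, \<open>base\<close> is 3 + i, an idempotent: (3 + i)^2 = 8 + 6i. So all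
  positive powers are 3 + i modulo 5, which the two congruences encode, and none is real. This
  yields both the infinite order of the rotation and the density of directions.\<close>

lemma base_power_mod_5: "\<exists>a b::int. base ^ Suc n = Complex (of_int a) (of_int b) \<and>
    (a + 2 * b) mod 5 = 0 \<and> b mod 5 = 1"
proof (induction n)
  case 0
  show ?case by (rule exI[of _ 8], rule exI[of _ 1]) (simp add: base_def)
next
  case (Suc n)
  then obtain a b :: int where ab: "base ^ Suc n = Complex (of_int a) (of_int b)"
    "(a + 2 * b) mod 5 = 0" "b mod 5 = 1" by (elim exE conjE) (rule that)
  have "base ^ Suc (Suc n) = Complex (of_int (8 * a - b)) (of_int (a + 8 * b))"
    using ab(1) by (simp add: base_def complex_eq_iff)
  moreover have "(8 * a - b + 2 * (a + 8 * b)) mod 5 = 0"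
  proof -
    have "8 * a - b + 2 * (a + 8 * b) = 5 * (2 * a + 3 * b)" by simp
    then show ?thesis by (metis mod_mult_self1_is_0)
  qed
  moreover have "(a + 8 * b) mod 5 = 1"
  proof -
    obtain q where "a + 2 * b = 5 * q" using ab(2) by (auto elim: dvdE)
    then have "a + 8 * b = b + 5 * (b + q)" by simp
    then show ?thesis using ab(3) by (metis mod_mult_self2)
  qed
  ultimately show ?case by (intro exI conjI)
qed

lemma Im_base_power_nonzero: "n > 0 \<Longrightarrow> Im (base ^ n) \<noteq> 0"
  using base_power_mod_5[of "n - 1"] by (cases n) (auto simp del: power_Suc)

lemma cmod_digit_le: "cmod (digit i) \<le> 14143/10000"
proof -
  have sq: "(real (k mod 3) - 1)\<^sup>2 \<le> 1" for k :: nat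
  proof -
    have "k mod 3 = 0 \<or> k mod 3 = 1 \<or> k mod 3 = 2" by linarith
    then show ?thesis by auto
  qed
  have "cmod (digit i) \<le> sqrt 2"
    unfolding cmod_def digit_def using sq[of i] sq[of "i div 3"] by (intro real_sqrt_le_mono) simp
  also have "\<dots> \<le> 14143/10000"
    by (rule real_le_lsqrt) (simp_all add: power2_eq_square)
  finally show ?thesis .
qed

lemma digit_inj: "inj_on digit {..<9}"
proof (rule inj_onI)
  fix i j assume "i \<in> {..<9::nat}" "j \<in> {..<9}" "digit i = digit j"
  then have "i mod 3 = j mod 3" "i div 3 mod 3 = j div 3 mod 3" "i div 3 < 3" "j div 3 < 3"
    by (auto simp: digit_def)
  then show "i = j" by (metis div_mult_mod_eq mod_less)
qed

lemma digit_separated: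
  assumes "digit i \<noteq> digit j"
  shows "1 \<le> cmod (digit i - digit j)"
proof -
  define a b where "a = int (i mod 3) - int (j mod 3)"
    and "b = int (i div 3 mod 3) - int (j div 3 mod 3)"
  have e: "digit i - digit j = Complex (of_int a) (of_int b)"
    by (simp add: digit_def a_def b_def complex_eq_iff)
  with assms have "a \<noteq> 0 \<or> b \<noteq> 0" by (auto simp: complex_eq_iff)
  then have "1 \<le> \<bar>real_of_int a\<bar> \<or> 1 \<le> \<bar>real_of_int b\<bar>" by linarith
  moreover have "\<bar>real_of_int a\<bar> \<le> cmod (digit i - digit j)"
    "\<bar>real_of_int b\<bar> \<le> cmod (digit i - digit j)"
    using abs_Re_le_cmod[of "digit i - digit j"] abs_Im_le_cmod[of "digit i - digit j"]
    by (simp_all add: e)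
  ultimately show ?thesis by linarith
qed

definition code :: "nat stream \<Rightarrow> complex" where
  "code s = (\<Sum>n. digit (s !! n) / base ^ Suc n)"

lemma cmod_code_term_le:
  "cmod (digit (s !! n) / base ^ Suc n) \<le> 14143/80600 * (100/806) ^ n"
proof -
  have "cmod (digit (s !! n) / base ^ Suc n) = cmod (digit (s !! n)) / cmod base ^ Suc n"
    by (simp add: norm_divide norm_power norm_mult)
  also have "\<dots> \<le> (14143/10000) / (806/100) ^ Suc n"
    by (intro frac_le cmod_digit_le power_mono cmod_base_ge) auto
  also have "\<dots> = 14143/80600 * (100/806) ^ n"
    by (simp add: field_simps)
  finally show ?thesis .
qed

lemma summable_code: "summable (\<lambda>n. digit (s !! n) / base ^ Suc n)"
  by (rule summable_comparison_test'[where g = "\<lambda>n. 14143/80600 * (100/806) ^ n", OF _ cmod_code_term_le])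
     (intro summable_mult summable_geometric, simp)

text \<open>The geometric series is just above 0.2. Two later facts rest on this size: the diameter
  0.402 is less than the distance 1 between digits, and 1.1 * 0.201 stays below 1/4.\<close>

lemma cmod_code_le: "cmod (code s) \<le> 201/1000"
proof -
  have s: "summable (\<lambda>n. 14143/80600 * (100/806::real) ^ n)"
    by (intro summable_mult summable_geometric) simp
  have s': "summable (\<lambda>n. cmod (digit (s !! n) / base ^ Suc n))"
    by (rule summable_comparison_test'[OF s, of 0]) (use cmod_code_term_le in auto)
  have "cmod (code s) \<le> (\<Sum>n. cmod (digit (s !! n) / base ^ Suc n))"
    unfolding code_def by (rule summable_norm[OF s'])
  also have "\<dots> \<le> (\<Sum>n. 14143/80600 * (100/806::real) ^ n)"
    by (rule suminf_le[OF cmod_code_term_le s' s])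
  also have "\<dots> = 14143/80600 * (1 / (1 - 100/806))"
    by (subst suminf_mult) (auto simp: suminf_geometric intro: summable_geometric)
  also have "\<dots> \<le> 201/1000" by simp
  finally show ?thesis .
qed

lemma code_Stream: "code (i ## s) = (digit i + code s) / base"
proof -
  have "code (i ## s) = digit i / base + (\<Sum>n. digit (s !! n) / base ^ Suc (Suc n))"
    unfolding code_def using suminf_split_head[OF summable_code[of "i ## s"]] by simp
  also have "(\<Sum>n. digit (s !! n) / base ^ Suc (Suc n)) = (\<Sum>n. (digit (s !! n) / base ^ Suc n) / base)"
    by (simp add: field_simps)
  also have "\<dots> = code s / base"
    unfolding code_def by (rule suminf_divide[OF summable_code])
  finally show ?thesis by (simp add: add_divide_distrib)
qed

lemma base_mult_code: "base * code s = digit (shd s) + code (stl s)"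
  using code_Stream[of "shd s" "stl s"] by simp

text \<open>\<open>base\<close> and all digits are Gaussian integers, so each multiplication by
  \<open>base\<close> shifts the sequence and adds only Gaussian integers.\<close>

lemma base_power_mult_code:
  "\<exists>a b::int. base ^ n * code s = code (sdrop n s) + Complex (of_int a) (of_int b)"
proof (induction n arbitrary: s)
  case 0
  show ?case by (rule exI[of _ 0], rule exI[of _ 0]) (simp add: complex_eq_iff)
next
  case (Suc n)
  obtain a b :: int where ab: "base ^ n * code s = code (sdrop n s) + Complex (of_int a) (of_int b)"
    using Suc by blast
  define i where "i = s !! n"
  have "base ^ Suc n * code s = base * code (sdrop n s) + base * Complex (of_int a) (of_int b)"
    using ab by (simp add: distrib_left mult.assoc)
  also have "\<dots> = code (sdrop (Suc n) s) + (digit i + base * Complex (of_int a) (of_int b))"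
    by (simp add: base_mult_code i_def)
  also have "digit i + base * Complex (of_int a) (of_int b) =
      Complex (of_int (int (i mod 3) - 1 + 8 * a - b)) (of_int (int (i div 3 mod 3) - 1 + a + 8 * b))"
    by (simp add: digit_def base_def complex_eq_iff)
  finally show ?case by blast
qed

text \<open>The codes of the tails differ by at most 0.402, twice the radius, and each common digit
  contracts the difference by 1 / sqrt 65 < 1/8.\<close>

lemma code_common_prefix:
  "stake n s = stake n s' \<Longrightarrow> cmod (code s - code s') \<le> 402/1000 / 8 ^ n"
proof (induction n arbitrary: s s')
  case 0
  have "cmod (code s - code s') \<le> cmod (code s) + cmod (code s')" by (rule norm_triangle_ineq4)
  then show ?case using cmod_code_le[of s] cmod_code_le[of s'] by simp
next
  case (Suc n)
  then have e: "shd s = shd s'" and t: "stake n (stl s) = stake n (stl s')" by auto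
  have "base * (code s - code s') = code (stl s) - code (stl s')"
    by (simp add: right_diff_distrib base_mult_code e)
  then have "cmod base * cmod (code s - code s') = cmod (code (stl s) - code (stl s'))"
    by (metis norm_mult)
  also have "\<dots> \<le> 402/1000 / 8 ^ n" by (rule Suc.IH[OF t])
  finally have "8 * cmod (code s - code s') \<le> 402/1000 / 8 ^ n"
    using cmod_base_ge mult_right_mono[of 8 "cmod base" "cmod (code s - code s')"] by simp
  then show ?case by (simp add: field_simps)
qed

section \<open>The plane as the complex numbers\<close>

definition vec_of_complex :: "complex \<Rightarrow> real^2" where
  "vec_of_complex z = vector [Re z, Im z]"

lemma vec_of_complex_nth [simp]:
  "vec_of_complex z $ 1 = Re z" "vec_of_complex z $ 2 = Im z"
  by (simp_all add: vec_of_complex_def)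

lemma vec2_eq_iff: "x = y \<longleftrightarrow> x $ 1 = y $ 1 \<and> x $ 2 = (y :: real^2) $ 2"
  by (simp add: vec_eq_iff forall_2)

lemma linear_vec_of_complex: "linear vec_of_complex"
  by (rule linearI) (simp_all add: vec2_eq_iff)

lemma norm_vec_of_complex [simp]: "norm (vec_of_complex z) = cmod z"
  by (simp add: norm_vec_def L2_set_def UNIV_2 cmod_def)

lemma inner_vec_of_complex: "vec_of_complex z \<bullet> vec_of_complex w = Re (cnj z * w)"
  by (simp add: inner_vec_def UNIV_2)

lemma vec_of_complex_surj: "vec_of_complex (Complex (x $ 1) (x $ 2)) = x"
  by (simp add: vec2_eq_iff)

lemmas vec_of_complex_linear_simps =
  linear_add[OF linear_vec_of_complex] linear_diff[OF linear_vec_of_complex]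
  linear_scale[OF linear_vec_of_complex] linear_0[OF linear_vec_of_complex]

lemma dist_vec_of_complex [simp]: "dist (vec_of_complex z) (vec_of_complex w) = dist z w"
  by (simp add: dist_norm flip: vec_of_complex_linear_simps)

lemma vec_of_complex_eq_iff [simp]: "vec_of_complex z = vec_of_complex w \<longleftrightarrow> z = w"
  by (simp add: vec2_eq_iff complex_eq_iff)

lemma continuous_vec_of_complex: "continuous_on S vec_of_complex"
  by (rule linear_continuous_on) (simp add: linear_conv_bounded_linear[symmetric] linear_vec_of_complex)

lemma measurable_vec_of_complex [measurable]: "vec_of_complex \<in> borel_measurable borel"
  by (intro borel_measurable_continuous_onI continuous_vec_of_complex)

section \<open>The rotation and the contractions\<close>

definition ratio :: real where
  "ratio = 1 / sqrt 65"

text \<open>The matrix of multiplication by (8 - i) / sqrt 65 = sqrt 65 / \<open>base\<close>, so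
  that \<open>ratio\<close> times it is division by \<open>base\<close>.\<close>

definition rot :: "real^2^2" where
  "rot = vector [vector [8 / sqrt 65, 1 / sqrt 65], vector [- 1 / sqrt 65, 8 / sqrt 65]]"

definition shift_vec :: "nat \<Rightarrow> real^2" where
  "shift_vec i = vec_of_complex (digit i / base)"

lemma rot_nth: "rot $ 1 $ 1 = 8 / sqrt 65" "rot $ 1 $ 2 = 1 / sqrt 65"
  "rot $ 2 $ 1 = - 1 / sqrt 65" "rot $ 2 $ 2 = 8 / sqrt 65"
  by (simp_all add: rot_def)

lemma rotation_matrix_rot: "rotation_matrix rot"
proof -
  have "transpose rot ** rot = mat 1"
    by (simp add: vec_eq_iff forall_2 matrix_matrix_mult_def transpose_def sum_2 rot_nth mat_def)
  moreover have "det rot = 1" by (simp add: det_2 rot_nth)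
  ultimately show ?thesis
    unfolding rotation_matrix_def by (simp add: orthogonal_matrix)
qed

lemma rot_mult: "rot *v vec_of_complex z = vec_of_complex (of_real (sqrt 65) * z / base)"
proof -
  have "of_real (sqrt 65) * z / base = of_real (sqrt 65) * z * Complex (8/65) (-1/65)"
    by (simp only: divide_inverse inverse_base)
  moreover have "a / sqrt 65 = a * (sqrt 65 / 65)" for a :: real
    by (simp add: field_simps)
  ultimately show ?thesis
    by (simp add: vec2_eq_iff matrix_vector_mult_def sum_2 rot_nth algebra_simps del: times_divide_eq_right)
qed

text \<open>A power equal to the identity would fix 1 and make \<open>base ^ n\<close> the real
  number \<open>sqrt 65 ^ n\<close>.\<close>

lemma rot_power_neq_id: "n \<ge> 1 \<Longrightarrow> ((\<lambda>x. rot *v x) ^^ n) \<noteq> id"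
proof
  assume n: "n \<ge> 1" and id: "((\<lambda>x. rot *v x) ^^ n) = id"
  have "((\<lambda>x. rot *v x) ^^ n) (vec_of_complex 1) = vec_of_complex ((of_real (sqrt 65) / base) ^ n)"
    by (induction n) (simp_all add: rot_mult)
  with id have "vec_of_complex 1 = vec_of_complex ((of_real (sqrt 65) / base) ^ n)" by simp
  then have "1 = (of_real (sqrt 65) / base) ^ n" by simp
  then have "base ^ n = of_real (sqrt 65) ^ n" by (simp add: power_divide)
  also have "\<dots> = of_real (sqrt 65 ^ n)" by simp
  finally have "Im (base ^ n) = 0" by (metis Im_complex_of_real)
  then show False using Im_base_power_nonzero[of n] n by simp
qed

lemma sim_map_vec_of_complex:
  "sim_map ratio rot (shift_vec i) (vec_of_complex z) = vec_of_complex ((digit i + z) / base)"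
proof -
  have "ratio *\<^sub>R (complex_of_real (sqrt 65) * z / base) = z / base"
    by (simp add: scaleR_conv_of_real ratio_def)
  then show ?thesis
    by (simp add: sim_map_def rot_mult shift_vec_def add_divide_distrib add.commute
        flip: vec_of_complex_linear_simps)
qed

lemma dist_sim_map:
  "dist (sim_map ratio rot (shift_vec i) x) (sim_map ratio rot (shift_vec i) y) = ratio * dist x y"
proof -
  obtain z w where "x = vec_of_complex z" "y = vec_of_complex w"
    using vec_of_complex_surj by metis
  moreover have "dist ((digit i + z) / base) ((digit i + w) / base) = ratio * dist z w"
    by (simp add: dist_norm norm_divide cmod_base ratio_def flip: diff_divide_distrib)
  ultimately show ?thesis
    by (simp add: sim_map_vec_of_complex)
qed

section \<open>The Bernoulli law on digit sequences\<close>

abbreviation digit_law :: "nat measure" where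
  "digit_law \<equiv> measure_pmf (pmf_of_set {..<9})"

abbreviation sequence_law :: "nat stream measure" where
  "sequence_law \<equiv> stream_space digit_law"

lemma space_sequence_law [simp]: "space sequence_law = UNIV"
  by (simp add: space_stream_space)

lemma prob_space_sequence_law: "prob_space sequence_law"
  by (intro prob_space.prob_space_stream_space measure_pmf.prob_space_axioms)

lemma sets_sequence_law_Collect: "Measurable.pred sequence_law P \<Longrightarrow> {s. P s} \<in> sets sequence_law"
  by (simp add: pred_def)

lemma measurable_code [measurable]: "code \<in> borel_measurable sequence_law"
proof (rule borel_measurable_LIMSEQ_metric)
  show "(\<lambda>n. \<Sum>k<n. digit (s !! k) / base ^ Suc k) \<longlonglongrightarrow> code s" for s
    unfolding code_def by (rule summable_LIMSEQ[OF summable_code])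
  show "(\<lambda>s. \<Sum>k<n. digit (s !! k) / base ^ Suc k) \<in> borel_measurable sequence_law" for n
    by measurable
qed

lemma nn_integral_digit_law: "(\<integral>\<^sup>+i. f i \<partial>digit_law) = (\<Sum>i<9. f i) / 9"
  by (subst nn_integral_pmf_of_set) (auto simp: lessThan_empty_iff)

text \<open>The first \<open>n\<close> digits are independent of the tail, which again has law
  \<open>sequence_law\<close>; so the tail may be resampled. The induction splits off one digit at a
  time.\<close>

lemma nn_integral_split_prefix:
  assumes [measurable]: "f \<in> borel_measurable sequence_law"
  shows "(\<integral>\<^sup>+s. f s \<partial>sequence_law) =
    (\<integral>\<^sup>+s. (\<integral>\<^sup>+s'. f (stake n s @- s') \<partial>sequence_law) \<partial>sequence_law)"
  using assms
proof (induction n arbitrary: f)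
  case 0
  interpret S: prob_space sequence_law by (rule prob_space_sequence_law)
  show ?case using S.emeasure_space_1 by simp
next
  case (Suc n)
  interpret S: prob_space sequence_law by (rule prob_space_sequence_law)
  note [measurable] = Suc.prems
  have "(\<integral>\<^sup>+s. f s \<partial>sequence_law) = (\<integral>\<^sup>+i. (\<integral>\<^sup>+s. f (i ## s) \<partial>sequence_law) \<partial>digit_law)"
    by (rule prob_space.nn_integral_stream_space[OF measure_pmf.prob_space_axioms]) measurable
  also have "\<dots> = (\<integral>\<^sup>+i. (\<integral>\<^sup>+s. (\<integral>\<^sup>+s'. f (i ## (stake n s @- s')) \<partial>sequence_law)
      \<partial>sequence_law) \<partial>digit_law)"
    by (intro nn_integral_cong Suc.IH) measurable
  also have "\<dots> = (\<integral>\<^sup>+i. (\<integral>\<^sup>+s. (\<integral>\<^sup>+s'. f (stake (Suc n) (i ## s) @- s') \<partial>sequence_law)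
      \<partial>sequence_law) \<partial>digit_law)"
    by simp
  also have "\<dots> = (\<integral>\<^sup>+s. (\<integral>\<^sup>+s'. f (stake (Suc n) s @- s') \<partial>sequence_law) \<partial>sequence_law)"
    by (rule prob_space.nn_integral_stream_space[OF measure_pmf.prob_space_axioms, symmetric]) measurable
  finally show ?case .
qed

lemma emeasure_stake_eq:
  assumes "set w \<subseteq> {..<9}"
  shows "emeasure sequence_law {s. stake (length w) s = w} = ennreal ((1/9) ^ length w)"
  using assms
proof (induction w)
  case Nil
  interpret S: prob_space sequence_law by (rule prob_space_sequence_law)
  show ?case using S.emeasure_space_1 by simp
next
  case (Cons a w)
  have "{s. stake (length (a # w)) s = a # w} \<in> sets sequence_law"
    by (rule sets_sequence_law_Collect) measurable
  then have "emeasure sequence_law {s. stake (length (a # w)) s = a # w} =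
      (\<Sum>i<9. emeasure sequence_law {s. i = a \<and> stake (length w) s = w}) / 9"
    by (subst prob_space.emeasure_stream_space[OF measure_pmf.prob_space_axioms]) (simp_all add: nn_integral_digit_law)
  also have "(\<Sum>i<9. emeasure sequence_law {s. i = a \<and> stake (length w) s = w}) =
      (\<Sum>i<9. if i = a then ennreal ((1/9) ^ length w) else 0)"
    using Cons by (intro sum.cong) auto
  also have "\<dots> = ennreal ((1/9) ^ length w)"
    using Cons.prems by simp
  also have "ennreal ((1/9) ^ length w) / 9 = ennreal ((1/9) ^ length (a # w))"
    by (simp add: divide_ennreal flip: ennreal_numeral)
  finally show ?case .
qed

lemma emeasure_stake_sdrop_neq:
  assumes "set w \<subseteq> {..<9}"
  shows "emeasure sequence_law {s. stake (length w) (sdrop j s) \<noteq> w} = ennreal (1 - (1/9) ^ length w)"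
proof -
  interpret S: prob_space sequence_law by (rule prob_space_sequence_law)
  have [measurable]: "{s. stake (length w) (sdrop j s) = w} \<in> sets sequence_law"
    by (rule sets_sequence_law_Collect) measurable
  have [measurable]: "{s. stake (length w) s = w} \<in> sets sequence_law"
    by (rule sets_sequence_law_Collect) measurable
  have "emeasure sequence_law {s. stake (length w) (sdrop j s) = w} =
      (\<integral>\<^sup>+s. indicator {s. stake (length w) (sdrop j s) = w} s \<partial>sequence_law)"
    by simp
  also have "\<dots> = (\<integral>\<^sup>+s. (\<integral>\<^sup>+s'. indicator {s. stake (length w) (sdrop j s) = w} (stake j s @- s')
      \<partial>sequence_law) \<partial>sequence_law)"
    by (rule nn_integral_split_prefix) measurable
  also have "\<dots> = (\<integral>\<^sup>+s. (\<integral>\<^sup>+s'. indicator {s. stake (length w) s = w} s'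
      \<partial>sequence_law) \<partial>sequence_law)"
    by (intro nn_integral_cong) (auto simp: sdrop_shift split: split_indicator)
  also have "\<dots> = ennreal ((1/9) ^ length w)"
    using emeasure_stake_eq[OF assms] S.emeasure_space_1
    by (subst nn_integral_indicator) simp_all
  finally have "measure sequence_law {s. stake (length w) (sdrop j s) = w} = (1/9) ^ length w"
    by (simp add: measure_def)
  then show ?thesis
    using S.prob_neg[of "\<lambda>s. stake (length w) (sdrop j s) = w"]
    by (simp add: S.emeasure_eq_measure)
qed

text \<open>The windows of length \<open>length w\<close> starting at the \<open>N k\<close> are
  disjoint, hence independent, and each misses \<open>w\<close> with probability 1 - 9^(-length
  w).\<close>

lemma emeasure_no_match_le:
  assumes "set w \<subseteq> {..<9}" "\<And>k. N k + length w \<le> N (Suc k)"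
  shows "emeasure sequence_law {s. \<forall>k<n. stake (length w) (sdrop (N k) s) \<noteq> w}
    \<le> ennreal ((1 - (1/9) ^ length w) ^ n)"
  using assms(2)
proof (induction n arbitrary: N)
  case 0
  interpret S: prob_space sequence_law by (rule prob_space_sequence_law)
  show ?case using S.emeasure_space_1 by simp
next
  case (Suc n)
  let ?p = "1 - (1/9::real) ^ length w"
  have p: "0 \<le> ?p" by (simp add: power_le_one)
  \<comment> \<open>Cut the sequence right after the first window: the tail is independent of that
    window, and \<open>N'\<close> gives the other positions relative to the cut.\<close>
  define m where "m = N 0 + length w"
  define N' where "N' k = N (Suc k) - m" for k
  have "N k \<le> N (Suc k)" for k
    using Suc.prems[of k] by linarith
  then have mono: "N (Suc 0) \<le> N (Suc k)" for k
    by (rule lift_Suc_mono_le) simp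
  have ge: "m \<le> N (Suc k)" for k
    using Suc.prems[of 0] mono[of k] unfolding m_def by linarith
  have N': "N' k + length w \<le> N' (Suc k)" for k
    using Suc.prems[of "Suc k"] ge[of k] by (simp add: N'_def)
  let ?A = "{s. \<forall>k<Suc n. stake (length w) (sdrop (N k) s) \<noteq> w}"
  let ?B = "{s. stake (length w) (sdrop (N 0) s) \<noteq> w}"
  let ?C = "{s. \<forall>k<n. stake (length w) (sdrop (N' k) s) \<noteq> w}"
  have [measurable]: "?A \<in> sets sequence_law"
    by (rule sets_sequence_law_Collect) measurable
  have [measurable]: "?B \<in> sets sequence_law"
    by (rule sets_sequence_law_Collect) measurable
  have [measurable]: "?C \<in> sets sequence_law"
    by (rule sets_sequence_law_Collect) measurable
  have split: "indicator ?A (stake m s @- s') = indicator ?B s * (indicator ?C s' :: ennreal)" for s s'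
  proof -
    have "stake (length w) (sdrop (N 0) (stake m s @- s')) = stake (length w) (sdrop (N 0) s)"
      unfolding m_def by (simp add: sdrop_shift stake_shift drop_stake take_stake)
    moreover have "sdrop (N (Suc k)) (stake m s @- s') = sdrop (N' k) s'" for k
      using ge[of k] by (simp add: sdrop_shift N'_def)
    ultimately have "stake m s @- s' \<in> ?A \<longleftrightarrow> s \<in> ?B \<and> s' \<in> ?C"
      by (auto simp: less_Suc_eq_0_disj)
    then show ?thesis by (simp add: indicator_def)
  qed
  have "emeasure sequence_law ?A = (\<integral>\<^sup>+s. indicator ?A s \<partial>sequence_law)" by simp
  also have "\<dots> = (\<integral>\<^sup>+s. (\<integral>\<^sup>+s'. indicator ?A (stake m s @- s') \<partial>sequence_law) \<partial>sequence_law)"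
    by (rule nn_integral_split_prefix) measurable
  also have "\<dots> = (\<integral>\<^sup>+s. (\<integral>\<^sup>+s'. indicator ?B s * indicator ?C s' \<partial>sequence_law) \<partial>sequence_law)"
    by (simp only: split)
  also have "\<dots> = emeasure sequence_law ?B * emeasure sequence_law ?C"
    by (simp add: nn_integral_cmult nn_integral_multc)
  also have "\<dots> \<le> ennreal ?p * ennreal (?p ^ n)"
    using emeasure_stake_sdrop_neq[OF assms(1)] Suc.IH[of N'] N' by (intro mult_mono) auto
  also have "\<dots> = ennreal (?p ^ Suc n)"
    using p by (simp add: ennreal_mult)
  finally show ?case .
qed

text \<open>Along a subsequence of positions spaced by at least the length of \<open>w\<close>,
  avoiding \<open>w\<close> forever has probability at most every power of a number below 1. This
  holds beyond any index \<open>m\<close>.\<close>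

lemma AE_frequently_match:
  assumes w: "set w \<subseteq> {..<9}" and N: "filterlim N at_top sequentially"
  shows "AE s in sequence_law. \<exists>\<^sub>F k in sequentially. stake (length w) (sdrop (N k) s) = w"
proof -
  interpret S: prob_space sequence_law by (rule prob_space_sequence_law)
  have "AE s in sequence_law. \<exists>k\<ge>m. stake (length w) (sdrop (N k) s) = w" for m
  proof -
    have step: "\<exists>k'\<ge>m. N k + length w \<le> N k'" for k
    proof -
      have "eventually (\<lambda>k'. N k + length w \<le> N k') sequentially"
        using N by (auto simp: filterlim_at_top)
      then have "eventually (\<lambda>k'. N k + length w \<le> N k' \<and> m \<le> k') sequentially"
        using eventually_ge_at_top by (rule eventually_conj)
      then show ?thesis using eventually_happens'[OF sequentially_bot] by blast
    qed
    obtain g where g: "\<And>k. g k \<ge> m" "\<And>k. N (g k) + length w \<le> N (g (Suc k))"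
      using dependent_nat_choice[of "\<lambda>_ k. m \<le> k" "\<lambda>_ k k'. N k + length w \<le> N k'"] step by blast
    let ?A = "{s. \<forall>k\<ge>m. stake (length w) (sdrop (N k) s) \<noteq> w}"
    have A: "?A \<in> sets sequence_law" by (rule sets_sequence_law_Collect) measurable
    have le: "measure sequence_law ?A \<le> (1 - (1/9) ^ length w) ^ n" for n
    proof -
      have "emeasure sequence_law ?A \<le>
          emeasure sequence_law {s. \<forall>k<n. stake (length w) (sdrop (N (g k)) s) \<noteq> w}"
        using g(1) by (intro emeasure_mono sets_sequence_law_Collect) (auto, measurable)
      also have "\<dots> \<le> ennreal ((1 - (1/9) ^ length w) ^ n)"
        using emeasure_no_match_le[OF w, of "\<lambda>k. N (g k)"] g(2) by simp
      finally show ?thesis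
        by (simp add: S.emeasure_eq_measure power_le_one)
    qed
    have "(\<lambda>n. (1 - (1/9::real) ^ length w) ^ n) \<longlonglongrightarrow> 0"
      by (rule LIMSEQ_power_zero) (simp add: power_le_one)
    then have "measure sequence_law ?A \<le> 0"
      by (rule LIMSEQ_le_const) (use le in auto)
    then have "measure sequence_law ?A = 0" by (simp add: measure_le_0_iff)
    then have "?A \<in> null_sets sequence_law"
      using A by (simp add: S.emeasure_eq_measure null_sets_def)
    then show ?thesis
      by (rule AE_I') auto
  qed
  then have "AE s in sequence_law. \<forall>m. \<exists>k\<ge>m. stake (length w) (sdrop (N k) s) = w"
    by (simp add: AE_all_countable)
  then show ?thesis
    by (simp add: frequently_sequentially)
qed

section \<open>Orbits approaching the minimal real part\<close>

lemma digit_mod: "digit (i mod 9) = digit i"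
proof -
  have "i mod 9 mod 3 = i mod 3" by (simp add: mod_mod_cancel)
  moreover have "i mod 9 div 3 mod 3 = i div 3 mod 3"
    using mod_mult2_eq[of i 3 3] by simp
  ultimately show ?thesis by (simp add: digit_def)
qed

text \<open>Arbitrary streams thus give no codes beyond those of streams with entries below 9, the
  only words that the law charges.\<close>

lemma code_smap_mod: "code (smap (\<lambda>i. i mod 9) s) = code s"
  by (simp add: code_def digit_mod)

definition min_Re :: real where
  "min_Re = (INF s. Re (code s))"

lemma bdd_below_Re_code: "bdd_below (range (\<lambda>s. Re (code s)))"
proof (rule bdd_belowI2)
  show "- (201/1000) \<le> Re (code s)" for s
    using abs_Re_le_cmod[of "code s"] cmod_code_le[of s] by linarith
qed

text \<open>A stream whose code nearly attains the infimum has a long prefix that recurs along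
  almost every sequence, and a common prefix forces close codes. There are countably many words, so
  one null set serves them all.\<close>

lemma AE_frequently_near_min_Re:
  assumes N: "filterlim N at_top sequentially"
  shows "AE s in sequence_law. \<forall>e>0. \<exists>\<^sub>F k in sequentially. Re (code (sdrop (N k) s)) < min_Re + e"
proof -
  have "AE s in sequence_law. \<forall>w\<in>lists {..<9}. \<exists>\<^sub>F k in sequentially. stake (length w) (sdrop (N k) s) = w"
    using AE_frequently_match[OF _ N] by (subst AE_ball_countable) (auto simp: lists_eq_set)
  then show ?thesis
  proof eventually_elim
    case (elim s)
    show ?case
    proof (intro allI impI)
      fix e :: real assume e: "e > 0"
      obtain t0 where "Re (code t0) < min_Re + e / 2"
        using cINF_less_iff[OF _ bdd_below_Re_code, of "min_Re + e/2"] e by (auto simp: min_Re_def)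
      \<comment> \<open>Reducing the entries modulo 9 keeps the code and makes every prefix a word
        of positive probability.\<close>
      then obtain t where t: "Re (code t) < min_Re + e / 2" "\<And>n. t !! n < 9"
        using that[of "smap (\<lambda>i. i mod 9) t0"] by (simp add: code_smap_mod)
      obtain L where "402/1000 / (e/2) < 8 ^ L"
        using real_arch_pow[of 8 "402/1000 / (e/2)"] by auto
      then have L: "402/1000 / 8 ^ L < e / 2"
        using e by (simp add: field_simps)
      have "stake L t \<in> lists {..<9}"
        using t(2) by (auto simp: lists_eq_set in_set_conv_nth)
      with elim have "\<exists>\<^sub>F k in sequentially. stake (length (stake L t)) (sdrop (N k) s) = stake L t"
        by blast
      then show "\<exists>\<^sub>F k in sequentially. Re (code (sdrop (N k) s)) < min_Re + e"
      proof (rule frequently_elim1)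
        fix k assume "stake (length (stake L t)) (sdrop (N k) s) = stake L t"
        then have "cmod (code (sdrop (N k) s) - code t) \<le> 402/1000 / 8 ^ L"
          by (intro code_common_prefix) simp
        then show "Re (code (sdrop (N k) s)) < min_Re + e"
          using L t(1) abs_Re_le_cmod[of "code (sdrop (N k) s) - code t"] by simp
      qed
    qed
  qed
qed

section \<open>The self-similar measure and its dimension\<close>

text \<open>After taking logarithms the constants contribute only ln C / ln \<rho>, which tends to
  0. Since ln \<rho> < 0, the upper constant \<open>C2\<close> gives the lower bound and
  \<open>C1\<close> the upper one.\<close>

lemma tendsto_local_dimension:
  fixes f :: "real \<Rightarrow> real"
  assumes "0 < C1" and bounds: "\<And>\<rho>. 0 < \<rho> \<Longrightarrow> \<rho> < \<delta> \<Longrightarrow> C1 * \<rho> powr d \<le> f \<rho> \<and> f \<rho> \<le> C2 * \<rho> powr d"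
    and "0 < \<delta>"
  shows "((\<lambda>\<rho>. ln (f \<rho>) / ln \<rho>) \<longlongrightarrow> d) (at_right 0)"
proof -
  have C2: "C2 > 0"
  proof -
    have "0 < C1 * (\<delta>/2) powr d" using assms(1,3) by simp
    also have "\<dots> \<le> f (\<delta>/2)" using bounds[of "\<delta>/2"] assms(3) by simp
    also have "\<dots> \<le> C2 * (\<delta>/2) powr d" using bounds[of "\<delta>/2"] assms(3) by simp
    finally show ?thesis using assms(3) by (simp add: zero_less_mult_iff)
  qed
  have inf: "filterlim (ln :: real \<Rightarrow> real) at_infinity (at_right 0)"
    by (rule filterlim_at_bot_imp_at_infinity[OF ln_at_0])
  have lim: "((\<lambda>\<rho>. d + ln C / ln \<rho>) \<longlongrightarrow> d) (at_right 0)" for C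
    using tendsto_add[OF tendsto_const[of d] tendsto_divide_0[OF tendsto_const[of "ln C"] inf]] by simp
  have ev: "eventually (\<lambda>\<rho>::real. 0 < \<rho> \<and> \<rho> < min \<delta> 1) (at_right 0)"
    using assms(3) by (auto simp: eventually_at_right[of 0 1] intro!: exI[of _ "min \<delta> 1"])
  have between: "d + ln C2 / ln \<rho> \<le> ln (f \<rho>) / ln \<rho>" "ln (f \<rho>) / ln \<rho> \<le> d + ln C1 / ln \<rho>"
    if \<rho>: "0 < \<rho>" "\<rho> < \<delta>" "\<rho> < 1" for \<rho>
  proof -
    have neg: "ln \<rho> < 0" using \<rho> by simp
    have p: "0 < C1 * \<rho> powr d" using assms(1) \<rho> by simp
    note b = bounds[OF \<rho>(1,2)]
    have fpos: "0 < f \<rho>" using p b by linarith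
    have "ln (C1 * \<rho> powr d) \<le> ln (f \<rho>)" using b p fpos by simp
    then have 1: "ln C1 + d * ln \<rho> \<le> ln (f \<rho>)" using assms(1) \<rho> by (simp add: ln_mult ln_powr)
    have "ln (f \<rho>) \<le> ln (C2 * \<rho> powr d)" using b fpos C2 \<rho> by (subst ln_le_cancel_iff) auto
    then have 2: "ln (f \<rho>) \<le> ln C2 + d * ln \<rho>" using C2 \<rho> by (simp add: ln_mult ln_powr)
    have "d + ln C / ln \<rho> = (ln C + d * ln \<rho>) / ln \<rho>" for C
      using neg by (simp add: field_simps)
    then show "d + ln C2 / ln \<rho> \<le> ln (f \<rho>) / ln \<rho>" "ln (f \<rho>) / ln \<rho> \<le> d + ln C1 / ln \<rho>"
      using 1 2 neg by (simp_all add: divide_right_mono_neg)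
  qed
  show ?thesis
    by (rule tendsto_sandwich[OF _ _ lim[of C2] lim[of C1]])
       (rule eventually_mono[OF ev], use between in auto)+
qed

lemma power_sandwich:
  fixes q t :: real
  assumes "0 < q" "q < 1" "0 < t" "t \<le> 1"
  obtains n where "q ^ Suc n < t" "t \<le> q ^ n"
proof -
  obtain m where m: "q ^ m < t"
    using real_arch_pow_inv[of t q] assms by auto
  define k where "k = (LEAST m. q ^ m < t)"
  have k: "q ^ k < t" unfolding k_def by (rule LeastI[of _ m]) (rule m)
  then have "k \<noteq> 0" using assms(4) by (cases k) auto
  then obtain n where n: "k = Suc n" by (cases k) auto
  then have "\<not> q ^ n < t" using not_less_Least[of n "\<lambda>m. q ^ m < t"] by (simp add: k_def)
  then show thesis using that[of n] k n by auto
qed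

section \<open>Attractor, separation and stationary measure\<close>

abbreviation ifs_map :: "nat \<Rightarrow> real^2 \<Rightarrow> real^2" where
  "ifs_map i \<equiv> sim_map ratio rot (shift_vec i)"

text \<open>Taking the closure makes compactness immediate; \<open>attractor_eq\<close> then
  identifies the set as the attractor.\<close>

definition attractor :: "(real^2) set" where
  "attractor = closure (range (\<lambda>s. vec_of_complex (code s)))"

definition stationary :: "(real^2) measure" where
  "stationary = distr sequence_law borel (\<lambda>s. vec_of_complex (code s))"

lemma ratio_pos: "0 < ratio" and ratio_less_1: "ratio < 1"
  by (simp_all add: ratio_def)

lemma ratio_gt: "1/9 < ratio"
proof -
  have "sqrt 65 < sqrt (9\<^sup>2)" by (rule real_sqrt_less_mono) simp
  then have "sqrt (65::real) < 9" by simp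
  then show ?thesis by (simp add: ratio_def field_simps)
qed

lemma continuous_ifs_map: "continuous_on S (ifs_map i)"
  by (rule continuous_on_subset[OF _ subset_UNIV], rule lipschitz_on_continuous_on[of ratio])
     (auto intro!: lipschitz_onI simp: dist_sim_map ratio_pos less_imp_le)

lemma measurable_ifs_map [measurable]: "ifs_map i \<in> borel_measurable borel"
  by (intro borel_measurable_continuous_onI continuous_ifs_map)

lemma attractor_subset_cball: "attractor \<subseteq> cball 0 (201/1000)"
  unfolding attractor_def by (rule closure_minimal) (use cmod_code_le in auto)

lemma closed_attractor: "closed attractor"
  by (simp add: attractor_def)

lemma compact_attractor: "compact attractor"
  using bounded_subset[OF bounded_cball attractor_subset_cball] closed_attractor
  by (simp add: compact_eq_bounded_closed)

lemma code_in_attractor: "vec_of_complex (code s) \<in> attractor"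
  unfolding attractor_def using closure_subset by fast

lemma ifs_map_code: "ifs_map i (vec_of_complex (code s)) = vec_of_complex (code (i ## s))"
  by (simp add: sim_map_vec_of_complex code_Stream)

lemma attractor_eq: "attractor = (\<Union>i<9. ifs_map i ` attractor)"
proof
  let ?X = "range (\<lambda>s. vec_of_complex (code s))"
  have "?X \<subseteq> (\<Union>i<9. ifs_map i ` attractor)"
  proof safe
    fix s :: "nat stream"
    have "vec_of_complex (code s) = ifs_map (shd s mod 9) (vec_of_complex (code (stl s)))"
      using base_mult_code[of s] by (simp add: sim_map_vec_of_complex digit_mod field_simps)
    then show "vec_of_complex (code s) \<in> (\<Union>i<9. ifs_map i ` attractor)"
      using code_in_attractor by (intro UN_I[of "shd s mod 9"]) auto
  qed
  moreover have "closed (\<Union>i<9. ifs_map i ` attractor)"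
    by (intro closed_UN finite_lessThan ballI compact_imp_closed
        compact_continuous_image[OF continuous_ifs_map compact_attractor])
  ultimately show "attractor \<subseteq> (\<Union>i<9. ifs_map i ` attractor)"
    unfolding attractor_def by (intro closure_minimal)
next
  have "ifs_map i ` attractor \<subseteq> attractor" for i
  proof -
    have "ifs_map i ` closure (range (\<lambda>s. vec_of_complex (code s))) \<subseteq> attractor"
      by (rule image_closure_subset[OF continuous_ifs_map closed_attractor])
         (auto simp: ifs_map_code code_in_attractor)
    then show ?thesis by (simp add: attractor_def)
  qed
  then show "(\<Union>i<9. ifs_map i ` attractor) \<subseteq> attractor" by blast
qed

text \<open>Distinct digits are at distance at least 1; moving both by points of norm at most 0.201
  leaves 0.598, and the contraction ratio exceeds 1/9.\<close>

lemma ifs_pieces_separated: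
  assumes "i < 9" "j < 9" "i \<noteq> j" "x \<in> attractor" "y \<in> attractor"
  shows "1/20 \<le> dist (ifs_map i x) (ifs_map j y)"
proof -
  define z w where "z = Complex (x $ 1) (x $ 2)" and "w = Complex (y $ 1) (y $ 2)"
  have xy: "x = vec_of_complex z" "y = vec_of_complex w"
    by (simp_all add: z_def w_def vec_of_complex_surj)
  have "cmod z \<le> 201/1000" "cmod w \<le> 201/1000"
    using assms(4,5) attractor_subset_cball by (auto simp: xy)
  then have "cmod (w - z) \<le> 402/1000" using norm_triangle_ineq4[of w z] by simp
  moreover have "1 \<le> cmod (digit i - digit j)"
    using assms digit_inj by (intro digit_separated) (auto dest: inj_onD)
  moreover have "cmod (digit i - digit j) \<le> cmod ((digit i + z) - (digit j + w)) + cmod (w - z)"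
    using norm_triangle_ineq[of "(digit i + z) - (digit j + w)" "w - z"] by simp
  ultimately have *: "598/1000 \<le> cmod ((digit i + z) - (digit j + w))" by simp
  have "dist (ifs_map i x) (ifs_map j y) = dist ((digit i + z) / base) ((digit j + w) / base)"
    by (simp only: xy sim_map_vec_of_complex dist_vec_of_complex)
  also have "\<dots> = ratio * cmod ((digit i + z) - (digit j + w))"
    by (simp add: dist_norm norm_divide cmod_base ratio_def flip: diff_divide_distrib)
  finally have "dist (ifs_map i x) (ifs_map j y) = ratio * cmod ((digit i + z) - (digit j + w))" .
  moreover have "1/9 * (598/1000) \<le> ratio * cmod ((digit i + z) - (digit j + w))"
    using * ratio_gt by (intro mult_mono) auto
  ultimately show ?thesis by linarith
qed

lemma SSC_ifs: "SSC ratio rot {..<9} shift_vec"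
  unfolding SSC_def
proof (intro exI conjI ballI impI)
  show "compact attractor" by (rule compact_attractor)
  show "attractor \<noteq> {}" using code_in_attractor by blast
  show "attractor = (\<Union>i\<in>{..<9}. ifs_map i ` attractor)" by (rule attractor_eq)
  show "ifs_map i ` attractor \<inter> ifs_map j ` attractor = {}"
    if "i \<in> {..<9}" "j \<in> {..<9}" "i \<noteq> j" for i j
  proof -
    have "ifs_map i x \<noteq> ifs_map j y" if "x \<in> attractor" "y \<in> attractor" for x y
    proof
      assume "ifs_map i x = ifs_map j y"
      then have "dist (ifs_map i x) (ifs_map j y) = 0" by simp
      with ifs_pieces_separated[of i j x y] \<open>i \<in> {..<9}\<close> \<open>j \<in> {..<9}\<close> \<open>i \<noteq> j\<close> that
      show False by simp
    qed
    then show ?thesis by auto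
  qed
qed

lemma measurable_vec_code [measurable]:
  "(\<lambda>s. vec_of_complex (code s)) \<in> borel_measurable sequence_law"
  by measurable

lemma sets_stationary [simp]: "sets stationary = sets borel"
  and space_stationary [simp]: "space stationary = UNIV"
  by (simp_all add: stationary_def)

lemma prob_space_stationary: "prob_space stationary"
  unfolding stationary_def
  by (rule prob_space.prob_space_distr[OF prob_space_sequence_law]) measurable

lemma AE_stationary_attractor: "AE x in stationary. x \<in> attractor"
proof -
  have "{x \<in> space borel. x \<in> attractor} \<in> sets borel"
    by (simp add: closed_attractor)
  then show ?thesis
    unfolding stationary_def by (subst AE_distr_iff) (auto simp: code_in_attractor)
qed

lemma emeasure_stationary_compl: "emeasure stationary (UNIV - attractor) = 0"
  using AE_iff_measurable[of "UNIV - attractor" stationary "\<lambda>x. x \<in> attractor"]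
    AE_stationary_attractor closed_attractor by auto

text \<open>Condition on the first digit: prepending \<open>i\<close> to a sequence acts on codes as
  \<open>ifs_map i\<close>.\<close>

lemma emeasure_stationary_self_similar:
  assumes A: "A \<in> sets borel"
  shows "emeasure stationary A = (\<Sum>i<9. emeasure stationary (ifs_map i -` A)) / 9"
proof -
  let ?X = "\<lambda>s. vec_of_complex (code s)"
  have [measurable]: "A \<in> sets borel" by (rule A)
  have e: "emeasure stationary B = emeasure sequence_law (?X -` B)" if "B \<in> sets borel" for B
    unfolding stationary_def using that by (subst emeasure_distr) auto
  have X: "?X -` A \<in> sets sequence_law"
    using measurable_sets[OF measurable_vec_code A] by simp
  have "emeasure stationary A = emeasure sequence_law (?X -` A)"
    using A by (rule e)
  also have "\<dots> = (\<integral>\<^sup>+i. emeasure sequence_law {s \<in> space sequence_law. i ## s \<in> ?X -` A} \<partial>digit_law)"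
    by (rule prob_space.emeasure_stream_space[OF measure_pmf.prob_space_axioms X])
  also have "\<dots> = (\<Sum>i<9. emeasure sequence_law {s. i ## s \<in> ?X -` A}) / 9"
    by (simp add: nn_integral_digit_law)
  also have "(\<Sum>i<9. emeasure sequence_law {s. i ## s \<in> ?X -` A}) =
      (\<Sum>i<9. emeasure stationary (ifs_map i -` A))"
  proof (rule sum.cong[OF refl])
    fix i
    have "ifs_map i -` A \<in> sets borel"
      using measurable_sets[OF measurable_ifs_map A] by simp
    then show "emeasure sequence_law {s. i ## s \<in> ?X -` A} = emeasure stationary (ifs_map i -` A)"
      by (subst e) (auto simp: ifs_map_code vimage_def)
  qed
  finally show ?thesis .
qed

lemma self_similar_measure_stationary:
  "self_similar_measure ratio rot {..<9} shift_vec stationary"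
  unfolding self_similar_measure_def
proof (intro conjI ballI exI)
  show "prob_space stationary" by (rule prob_space_stationary)
  show "compact attractor" by (rule compact_attractor)
  show "emeasure stationary (UNIV - attractor) = 0" by (rule emeasure_stationary_compl)
  fix A :: "(real^2) set" assume A: "A \<in> sets borel"
  have "emeasure (distr stationary borel (ifs_map i)) A = emeasure stationary (ifs_map i -` A)" for i
  proof -
    have "ifs_map i \<in> measurable stationary borel"
      using measurable_ifs_map by (simp add: measurable_def)
    then show ?thesis using A by (subst emeasure_distr) simp_all
  qed
  moreover have "x / 9 = ennreal (1 / 9) * x" for x
  proof -
    have "ennreal (1 / 9) = inverse 9"
      using inverse_ennreal[of 9] by (simp add: inverse_eq_divide flip: ennreal_numeral)
    then show ?thesis by (simp add: divide_ennreal_def mult.commute)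
  qed
  ultimately show "emeasure stationary A = (\<Sum>i<9. ennreal (1 / real (card {..<9::nat})) *
      emeasure (distr stationary borel (ifs_map i)) A)"
    by (simp add: emeasure_stationary_self_similar[OF A] sum_distrib_left)
qed simp

section \<open>Measures of balls and exact dimension\<close>

lemma vimage_ifs_map_ball: "ifs_map i -` ball (ifs_map i x) \<rho> = ball x (\<rho> / ratio)"
  using ratio_pos by (auto simp: dist_sim_map field_simps)

text \<open>In the self-similarity relation the term of index \<open>i\<close> is the rescaled ball.
  For radius at most the separation 1/20 the other preimages miss the attractor, so this term is the
  only one.\<close>

lemma emeasure_stationary_ball:
  assumes "x \<in> attractor" "i < 9"
  shows "emeasure stationary (ball x (\<rho> / ratio)) / 9 \<le> emeasure stationary (ball (ifs_map i x) \<rho>)"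
    and "\<rho> \<le> 1/20 \<Longrightarrow>
      emeasure stationary (ball (ifs_map i x) \<rho>) = emeasure stationary (ball x (\<rho> / ratio)) / 9"
proof -
  let ?f = "\<lambda>j. emeasure stationary (ifs_map j -` ball (ifs_map i x) \<rho>)"
  have s: "emeasure stationary (ball (ifs_map i x) \<rho>) = (\<Sum>j<9. ?f j) / 9"
    by (rule emeasure_stationary_self_similar) simp
  have i: "?f i = emeasure stationary (ball x (\<rho> / ratio))"
    by (simp only: vimage_ifs_map_ball)
  have "?f i \<le> (\<Sum>j<9. ?f j)"
    using assms(2) by (intro member_le_sum) auto
  then show "emeasure stationary (ball x (\<rho> / ratio)) / 9 \<le> emeasure stationary (ball (ifs_map i x) \<rho>)"
    unfolding s i by (rule divide_right_mono_ennreal)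
  assume \<rho>: "\<rho> \<le> 1/20"
  have "?f j = 0" if "j < 9" "j \<noteq> i" for j
  proof -
    have "ifs_map j -` ball (ifs_map i x) \<rho> \<subseteq> UNIV - attractor"
      using ifs_pieces_separated[of i j x] that assms \<rho> by fastforce
    then have "?f j \<le> emeasure stationary (UNIV - attractor)"
      by (intro emeasure_mono) (auto simp: closed_attractor)
    then show ?thesis by (simp add: emeasure_stationary_compl)
  qed
  then have "(\<Sum>j<9. ?f j) = (\<Sum>j<9. if j = i then ?f i else 0)"
    by (intro sum.cong) auto
  also have "\<dots> = ?f i" using assms(2) by simp
  finally show "emeasure stationary (ball (ifs_map i x) \<rho>) = emeasure stationary (ball x (\<rho> / ratio)) / 9"
    unfolding s i by simp
qed

lemma measure_stationary_ball:
  assumes "x \<in> attractor" "i < 9"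
  shows "measure stationary (ball x (\<rho> / ratio)) / 9 \<le> measure stationary (ball (ifs_map i x) \<rho>)"
    and "\<rho> \<le> 1/20 \<Longrightarrow>
      measure stationary (ball (ifs_map i x) \<rho>) = measure stationary (ball x (\<rho> / ratio)) / 9"
proof -
  interpret prob_space stationary by (rule prob_space_stationary)
  have 9: "ennreal m / 9 = ennreal (m / 9)" if "m \<ge> 0" for m
    using that by (simp add: divide_ennreal flip: ennreal_numeral)
  show "measure stationary (ball x (\<rho> / ratio)) / 9 \<le> measure stationary (ball (ifs_map i x) \<rho>)"
    using emeasure_stationary_ball(1)[OF assms] by (simp add: emeasure_eq_measure 9)
  show "measure stationary (ball (ifs_map i x) \<rho>) = measure stationary (ball x (\<rho> / ratio)) / 9"
    if "\<rho> \<le> 1/20"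
    using emeasure_stationary_ball(2)[OF assms that] by (simp add: emeasure_eq_measure 9)
qed

lemma attractor_cases:
  assumes "x \<in> attractor"
  obtains i y where "i < 9" "y \<in> attractor" "x = ifs_map i y"
  using assms attractor_eq by blast

text \<open>Unwinding one map enlarges the radius by 1 / \<open>ratio\<close> and the mass by
  exactly 9 while the radius is at most 1/20. The hypothesis permits \<open>n\<close> such steps,
  and the final mass is at most 1.\<close>

lemma measure_stationary_ball_le:
  "x \<in> attractor \<Longrightarrow> \<rho> \<le> 1/20 * ratio ^ n \<Longrightarrow> measure stationary (ball x \<rho>) \<le> (1/9) ^ n"
proof (induction n arbitrary: x \<rho>)
  case 0
  interpret prob_space stationary by (rule prob_space_stationary)
  show ?case by simp
next
  case (Suc n)
  obtain i y where iy: "i < 9" "y \<in> attractor" "x = ifs_map i y"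
    using Suc.prems(1) by (rule attractor_cases)
  have "ratio ^ Suc n \<le> 1"
    using ratio_pos ratio_less_1 by (intro power_le_one) auto
  then have "\<rho> \<le> 1/20" using Suc.prems(2) by simp
  then have "measure stationary (ball x \<rho>) = measure stationary (ball y (\<rho> / ratio)) / 9"
    unfolding iy(3) by (rule measure_stationary_ball(2)[OF iy(2,1)])
  also have "\<rho> / ratio \<le> 1/20 * ratio ^ n"
    using Suc.prems(2) ratio_pos by (simp add: field_simps)
  then have "measure stationary (ball y (\<rho> / ratio)) / 9 \<le> (1/9) ^ n / 9"
    by (intro divide_right_mono Suc.IH iy) auto
  finally show ?case by simp
qed

text \<open>Unwinding \<open>n\<close> maps brings the radius to at least 1, and such a ball about a
  point of the attractor contains all of it, the diameter being at most 0.402.\<close>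

lemma measure_stationary_ball_ge:
  "x \<in> attractor \<Longrightarrow> ratio ^ n \<le> \<rho> \<Longrightarrow> (1/9) ^ n \<le> measure stationary (ball x \<rho>)"
proof (induction n arbitrary: x \<rho>)
  case 0
  interpret prob_space stationary by (rule prob_space_stationary)
  have "attractor \<subseteq> ball x \<rho>"
  proof
    fix y assume "y \<in> attractor"
    then have "norm y \<le> 201/1000" "norm x \<le> 201/1000"
      using 0 attractor_subset_cball by auto
    then have "norm (x - y) < 1" using norm_triangle_ineq4[of x y] by simp
    then show "y \<in> ball x \<rho>" using 0 by (simp add: dist_norm)
  qed
  then have "AE y in stationary. y \<in> ball x \<rho>"
    by (intro eventually_mono[OF AE_stationary_attractor]) blast
  then have "measure stationary (ball x \<rho>) = 1" by (subst prob_eq_1) auto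
  then show ?case by simp
next
  case (Suc n)
  obtain i y where iy: "i < 9" "y \<in> attractor" "x = ifs_map i y"
    using Suc.prems(1) by (rule attractor_cases)
  have "ratio ^ n \<le> \<rho> / ratio"
    using Suc.prems(2) ratio_pos by (simp add: field_simps)
  then have "(1/9) ^ n / 9 \<le> measure stationary (ball y (\<rho> / ratio)) / 9"
    by (intro divide_right_mono Suc.IH iy) auto
  also have "\<dots> \<le> measure stationary (ball x \<rho>)"
    unfolding iy(3) by (rule measure_stationary_ball(1)[OF iy(2,1)])
  finally show ?case by simp
qed

text \<open>The exponent \<open>d\<close> with \<open>9 * ratio powr d = 1\<close>.\<close>

definition similarity_dim :: real where
  "similarity_dim = ln 9 / ln (sqrt 65)"

lemma similarity_dim_gt_1: "similarity_dim > 1"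
proof -
  have "sqrt 65 < sqrt (9\<^sup>2)" by (rule real_sqrt_less_mono) simp
  then have "ln (sqrt 65) < ln (9::real)" by (subst ln_less_cancel_iff) simp_all
  moreover have "0 < ln (sqrt (65::real))" by (rule ln_gt_zero) simp
  ultimately show ?thesis by (simp add: similarity_dim_def)
qed

lemma ratio_powr_dim: "(ratio ^ n) powr similarity_dim = (1/9) ^ n"
proof -
  have "0 < ln (sqrt (65::real))" by (rule ln_gt_zero) simp
  then have dim: "ratio powr similarity_dim = 1/9"
    by (simp add: powr_def ratio_def similarity_dim_def ln_div exp_minus)
  have "(ratio ^ n) powr similarity_dim = (ratio powr similarity_dim) ^ n"
    using ratio_pos by (induction n) (simp_all add: powr_mult)
  then show ?thesis by (simp only: dim)
qed

lemma exact_dim_stationary: "exact_dim stationary similarity_dim"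
  unfolding exact_dim_def
proof (rule eventually_mono[OF AE_stationary_attractor])
  fix x assume x: "x \<in> attractor"
  let ?d = similarity_dim
  have d: "?d > 0" using similarity_dim_gt_1 by simp
  show "((\<lambda>\<rho>. ln (measure stationary (ball x \<rho>)) / ln \<rho>) \<longlongrightarrow> ?d) (at_right 0)"
  proof (rule tendsto_local_dimension[of "1/9" "1/20" ?d _ "9 * 20 powr ?d"])
    fix \<rho> :: real assume \<rho>: "0 < \<rho>" "\<rho> < 1/20"
    obtain n where n: "ratio ^ Suc n < \<rho>" "\<rho> \<le> ratio ^ n"
      using power_sandwich[of ratio \<rho>] ratio_pos ratio_less_1 \<rho> by auto
    have "1/9 * \<rho> powr ?d \<le> 1/9 * (ratio ^ n) powr ?d"
      using n(2) \<rho> d by (intro mult_left_mono powr_mono2) auto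
    also have "\<dots> = (1/9) ^ Suc n" by (simp add: ratio_powr_dim)
    also have "\<dots> \<le> measure stationary (ball x \<rho>)"
      using n(1) by (intro measure_stationary_ball_ge x) simp
    finally have lower: "1/9 * \<rho> powr ?d \<le> measure stationary (ball x \<rho>)" .
    \<comment> \<open>The factor 20 comes from the threshold 1/20 in the upper bound for balls;
      \<rho> < 1/20 keeps 20 \<rho> below 1.\<close>
    obtain m where m: "ratio ^ Suc m < 20 * \<rho>" "20 * \<rho> \<le> ratio ^ m"
      using power_sandwich[of ratio "20 * \<rho>"] ratio_pos ratio_less_1 \<rho> by auto
    have "measure stationary (ball x \<rho>) \<le> (1/9) ^ m"
      using m(2) by (intro measure_stationary_ball_le x) simp
    also have "\<dots> = 9 * (ratio ^ Suc m) powr ?d" by (simp add: ratio_powr_dim del: power_Suc) simp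
    also have "\<dots> \<le> 9 * (20 * \<rho>) powr ?d"
      using m(1) d ratio_pos by (intro mult_left_mono powr_mono2) auto
    also have "\<dots> = 9 * 20 powr ?d * \<rho> powr ?d"
      using \<rho> by (simp add: powr_mult)
    finally show "1/9 * \<rho> powr ?d \<le> measure stationary (ball x \<rho>) \<and>
        measure stationary (ball x \<rho>) \<le> 9 * 20 powr ?d * \<rho> powr ?d"
      using lower by simp
  qed simp_all
qed

section \<open>Generic directions\<close>

lemma cmod_cis_diff_le: "cmod (cis a - cis b) \<le> \<bar>a - b\<bar>"
proof -
  have "cis a - cis b = cis b * (cis (a - b) - 1)"
    by (simp add: right_diff_distrib cis_mult)
  then have "cmod (cis a - cis b) = cmod (exp (\<i> * of_real (a - b)) - 1)"
    by (simp add: norm_mult cis_conv_exp)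
  also have "\<dots> = 2 * \<bar>sin ((a - b) / 2)\<bar>" by (rule dist_exp_i_1)
  also have "\<dots> \<le> \<bar>a - b\<bar>" using abs_sin_x_le_abs_x[of "(a - b) / 2"] by simp
  finally show ?thesis .
qed

text \<open>If no positive power of \<open>cis \<phi>\<close> is 1, then \<phi> / (2 pi) is
  irrational, and Kronecker's density theorem for fractional parts applies.\<close>

lemma dense_powers_of_cis:
  assumes irr: "\<And>n::nat. n > 0 \<Longrightarrow> cis \<phi> ^ n \<noteq> 1" and "cmod w = 1" "\<epsilon> > 0"
  obtains N where "N \<ge> n" "cmod (cis \<phi> ^ N - w) < \<epsilon>"
proof -
  have "\<phi> / (2 * pi) \<notin> \<rat>"
  proof
    assume "\<phi> / (2 * pi) \<in> \<rat>"
    then obtain a b :: int where ab: "b > 0" "\<phi> / (2 * pi) = of_int a / of_int b"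
      by (rule Rats_cases')
    have "real (nat b) * \<phi> = 2 * pi * of_int a"
      using ab by (simp add: field_simps)
    then have "cis \<phi> ^ nat b = cis (2 * pi * of_int a)" by (simp only: Complex.DeMoivre)
    then have "cis \<phi> ^ nat b = 1" by (simp add: cis_multiple_2pi)
    then show False using irr[of "nat b"] ab(1) by simp
  qed
  moreover have "\<epsilon> / (2 * pi) > 0" using assms(3) by simp
  ultimately obtain h k where hk: "k > 0"
    "\<bar>of_int k * (\<phi> / (2 * pi)) - of_int h - (Arg w - real n * \<phi>) / (2 * pi)\<bar> < \<epsilon> / (2 * pi)"
    by (rule sequence_of_fractional_parts_is_dense)
  \<comment> \<open>The theorem was applied to the argument of \<open>w\<close> turned back by n
    \<phi>, so that adding \<open>n\<close> to the exponent hits \<open>w\<close> with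
    \<open>N \<ge> n\<close>.\<close>
  define N where "N = nat k + n"
  have "real N * \<phi> - (Arg w + 2 * pi * of_int h) =
      2 * pi * (of_int k * (\<phi> / (2 * pi)) - of_int h - (Arg w - real n * \<phi>) / (2 * pi))"
    using hk(1) by (simp add: N_def field_simps)
  then have "\<bar>real N * \<phi> - (Arg w + 2 * pi * of_int h)\<bar> =
      2 * pi * \<bar>of_int k * (\<phi> / (2 * pi)) - of_int h - (Arg w - real n * \<phi>) / (2 * pi)\<bar>"
    by (simp add: abs_mult)
  also have "\<dots> < 2 * pi * (\<epsilon> / (2 * pi))"
    using hk(2) by (intro mult_strict_left_mono) auto
  finally have lt: "\<bar>real N * \<phi> - (Arg w + 2 * pi * of_int h)\<bar> < \<epsilon>" by simp
  have "cis (Arg w + 2 * pi * of_int h) = cis (Arg w)"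
    by (simp add: cis_multiple_2pi flip: cis_mult)
  also have "\<dots> = w" using assms(2) by (metis mult_1 of_real_1 rcis_cmod_Arg rcis_def)
  finally have "cmod (cis \<phi> ^ N - w) \<le> \<bar>real N * \<phi> - (Arg w + 2 * pi * of_int h)\<bar>"
    using cmod_cis_diff_le[of "real N * \<phi>" "Arg w + 2 * pi * of_int h"] by (simp add: Complex.DeMoivre)
  then show thesis using lt that[of N] by (simp add: N_def)
qed

text \<open>The conjugate turns the inner product with \<open>x\<close> into Re (base^N x). The
  summand 1/10 makes the phase remember Re x while keeping it in an interval shorter than 1/2. The
  condition \<open>u $ 2 \<noteq> 0\<close> lets the second coordinate be solved for.\<close>

definition near_frequency :: "nat \<Rightarrow> (real^2) set" where
  "near_frequency n = {u \<in> sphere 0 1. u $ 2 \<noteq> 0 \<and>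
     (\<exists>t>real n. \<exists>N\<ge>n. norm (t *\<^sub>R u - vec_of_complex (cnj base ^ N + 1/10)) < 1 / real (Suc n))}"

lemma openin_near_frequency: "openin (top_of_set (sphere 0 1)) (near_frequency n)"
proof -
  let ?U = "{u::real^2. u $ 2 \<noteq> 0} \<inter> (\<Union>t\<in>{real n<..}. \<Union>N\<in>{n..}.
      {u. norm (t *\<^sub>R u - vec_of_complex (cnj base ^ N + 1/10)) < 1 / real (Suc n)})"
  have "open ?U"
    by (intro open_Int open_UN ballI open_Collect_neq open_Collect_less continuous_intros)
  moreover have "near_frequency n = sphere 0 1 \<inter> ?U"
    by (auto simp: near_frequency_def)
  ultimately show ?thesis by (metis openin_open_Int)
qed

text \<open>The argument of \<open>base\<close> is an irrational multiple of pi, so the directions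
  of \<open>cnj base ^ N\<close> are dense; adding 1/10 to such a long vector barely turns
  it.\<close>

lemma dense_near_frequency: "sphere 0 1 \<subseteq> closure (near_frequency n)"
proof
  fix u0 :: "real^2" assume u0: "u0 \<in> sphere 0 1"
  define w where "w = Complex (u0 $ 1) (u0 $ 2)"
  have w: "u0 = vec_of_complex w" by (simp add: w_def vec_of_complex_surj)
  have cw: "cmod w = 1" using u0 by (simp add: w)
  define \<phi> where "\<phi> = - Arg base"
  define q where "q = sqrt (65::real)"
  have q: "q > 0" "q \<ge> 8" using cmod_base_ge by (simp_all add: q_def cmod_base)
  have "base = of_real q * cis (Arg base)"
    using rcis_cmod_Arg[of base] by (simp add: rcis_def cmod_base q_def)
  then have base: "cnj base = of_real q * cis \<phi>"
    unfolding \<phi>_def by (metis cis_cnj complex_cnj_complex_of_real complex_cnj_mult)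
  have pow: "cnj base ^ N = of_real (q ^ N) * cis \<phi> ^ N" for N
    by (simp add: base power_mult_distrib)
  have Im0: "Im (cnj base ^ N) \<noteq> 0" if "N > 0" for N
    using Im_base_power_nonzero[OF that] by (simp flip: complex_cnj_power)
  have irr: "cis \<phi> ^ N \<noteq> 1" if "N > 0" for N
  proof
    assume "cis \<phi> ^ N = 1"
    then have "cnj base ^ N = of_real (q ^ N)" using pow[of N] by simp
    then show False using Im0[OF that] by (metis Im_complex_of_real)
  qed
  have "\<exists>u\<in>near_frequency n. dist u u0 < \<epsilon>" if \<epsilon>: "\<epsilon> > 0" for \<epsilon>
  proof -
    \<comment> \<open>The length of the vector must exceed \<open>n\<close>, as the definition
      demands, and 1 / \<epsilon>, to make the change of direction small; the extra 1 absorbs the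
      summand 1/10.\<close>
    obtain n0 where n0: "real n + 1 + 1 / \<epsilon> < 8 ^ n0"
      using real_arch_pow[of 8 "real n + 1 + 1/\<epsilon>"] by auto
    obtain N where N: "N \<ge> Suc (max n n0)" "cmod (cis \<phi> ^ N - w) < \<epsilon> / 2"
      using dense_powers_of_cis[of \<phi> w "\<epsilon>/2" "Suc (max n n0)"] irr cw \<epsilon> by auto
    \<comment> \<open>With \<open>t\<close> the length of \<open>c\<close>, the unit vector
      \<open>u\<close> in direction \<open>c\<close> satisfies t u = c exactly.\<close>
    define c t where "c = cnj base ^ N + 1/10" and "t = cmod c"
    have "(8::real) ^ n0 \<le> 8 ^ N" using N(1) by (intro power_increasing) auto
    also have "\<dots> \<le> q ^ N" using q by (intro power_mono) auto
    finally have qN: "real n + 1 + 1 / \<epsilon> < q ^ N" using n0 by linarith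
    have qN_eq: "cmod (cnj base ^ N) = q ^ N"
      unfolding pow using q by (simp add: norm_mult norm_power)
    have tq: "\<bar>t - q ^ N\<bar> \<le> 1/10"
      using norm_triangle_ineq3[of c "cnj base ^ N"] qN_eq by (simp add: c_def t_def)
    have "1 / \<epsilon> > 0" using \<epsilon> by simp
    then have t: "t > real n" "t > 1 / \<epsilon>" "t > 0" using tq qN by linarith+
    have Imc: "Im c \<noteq> 0" using Im0[of N] N(1) by (simp add: c_def)
    let ?u = "vec_of_complex (c / of_real t)"
    have tu: "t *\<^sub>R ?u = vec_of_complex c"
    proof -
      have "t *\<^sub>R (c / of_real t) = c" using t by (simp add: scaleR_conv_of_real)
      then show ?thesis by (metis linear_scale[OF linear_vec_of_complex])
    qed
    have "?u \<in> sphere 0 1" using t by (simp add: norm_divide) (simp add: t_def)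
    moreover have "?u $ 2 \<noteq> 0" using Imc t by simp
    moreover have "norm (t *\<^sub>R ?u - vec_of_complex (cnj base ^ N + 1/10)) < 1 / real (Suc n)"
      unfolding tu by (simp add: c_def)
    ultimately have "?u \<in> near_frequency n"
      unfolding near_frequency_def using t(1) N(1) by (intro CollectI conjI exI[of _ t] exI[of _ N]) auto
    moreover have "dist ?u u0 < \<epsilon>"
    proof -
      have "c - of_real t * cis \<phi> ^ N = of_real (q ^ N - t) * cis \<phi> ^ N + 1/10"
        unfolding c_def pow by (simp add: algebra_simps)
      then have "cmod (c - of_real t * cis \<phi> ^ N) \<le> cmod (of_real (q ^ N - t) * cis \<phi> ^ N) + cmod (1/10)"
        by (metis norm_triangle_ineq)
      also have "\<dots> = \<bar>q ^ N - t\<bar> + 1/10"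
        by (simp add: norm_mult norm_power norm_divide del: of_real_diff of_real_power)
      also have "\<dots> \<le> 1/5" using tq by linarith
      finally have "cmod (c - of_real t * cis \<phi> ^ N) \<le> 1/5" .
      moreover have "c / of_real t - cis \<phi> ^ N = (c - of_real t * cis \<phi> ^ N) / of_real t"
        using t by (simp add: field_simps)
      ultimately have "cmod (c / of_real t - cis \<phi> ^ N) \<le> (1/5) / t"
        using t by (simp add: norm_divide field_simps)
      also have "\<dots> < \<epsilon> / 5" using t \<epsilon> by (simp add: field_simps)
      finally have "cmod (c / of_real t - w) < \<epsilon> / 5 + \<epsilon> / 2"
        using N(2) norm_triangle_ineq[of "c / of_real t - cis \<phi> ^ N" "cis \<phi> ^ N - w"] by simp
      then show ?thesis using \<epsilon> by (simp add: w dist_norm[of "_ :: complex"])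
    qed
    ultimately show ?thesis by blast
  qed
  then show "u0 \<in> closure (near_frequency n)"
    by (simp add: closure_approachable)
qed

definition generic_directions :: "(real^2) set" where
  "generic_directions = (\<Inter>n. near_frequency n)"

text \<open>Baire's theorem on the closed unit circle gives density. Both sets of directions in the
  theorem will contain this same set.\<close>

lemma contains_dense_Gdelta_if_generic:
  assumes "generic_directions \<subseteq> X"
  shows "contains_dense_Gdelta (sphere 0 1) X"
  unfolding contains_dense_Gdelta_def
proof (intro exI conjI)
  show "generic_directions \<subseteq> X" by (rule assms)
  show "gdelta_in (top_of_set (sphere 0 1)) generic_directions"
    unfolding generic_directions_def
    by (rule gdelta_in_Inter) (auto intro: open_imp_gdelta_in openin_near_frequency)
  show "sphere 0 1 \<subseteq> closure generic_directions"
    unfolding generic_directions_def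
    by (rule Baire) (auto simp: openin_near_frequency intro: dense_near_frequency[THEN subsetD])
qed

section \<open>A single generic direction: phases, singularity, recovery of points\<close>

locale generic_direction =
  fixes u :: "real^2" and t :: "nat \<Rightarrow> real" and N :: "nat \<Rightarrow> nat"
  assumes norm_u: "norm u = 1" and u2: "u $ 2 \<noteq> 0"
    and t: "\<And>n. t n > real n" and N: "\<And>n. N n \<ge> n"
    and near: "\<And>n. norm (t n *\<^sub>R u - vec_of_complex (cnj base ^ N n + 1/10)) < 1 / real (Suc n)"

lemma generic_directionsE:
  assumes "u \<in> generic_directions"
  obtains t N where "generic_direction u t N"
proof -
  have u: "u \<in> near_frequency n" for n
    using assms by (auto simp: generic_directions_def)
  then have "\<forall>n. \<exists>t N. t > real n \<and> N \<ge> n \<and>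
      norm (t *\<^sub>R u - vec_of_complex (cnj base ^ N + 1/10)) < 1 / real (Suc n)"
    unfolding near_frequency_def by blast
  then obtain t N where "\<forall>n. t n > real n \<and> N n \<ge> n \<and>
      norm (t n *\<^sub>R u - vec_of_complex (cnj base ^ N n + 1/10)) < 1 / real (Suc n)"
    by metis
  moreover have "norm u = 1" "u $ 2 \<noteq> 0" using u[of 0] by (auto simp: near_frequency_def)
  ultimately show thesis using that[of t N] by (simp add: generic_direction_def)
qed

context generic_direction
begin

lemma t_at_top: "filterlim t at_top sequentially"
  by (rule filterlim_at_top_mono[OF filterlim_real_sequentially]) (intro always_eventually allI less_imp_le t)

lemma N_at_top: "filterlim N at_top sequentially"
  by (rule filterlim_at_top_mono[OF filterlim_ident]) (use N in auto)

text \<open>Pairing \<open>x\<close> with \<open>t n *\<^sub>R u\<close> gives Re (base^N x) + Re x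
  / 10 up to an error \<open>e\<close>, and base^N x is the code of the shifted sequence modulo
  Gaussian integers. For \<open>n \<ge> 20\<close> the sizes 0.2211 and 0.0096 add up to less than
  0.24, so no wrap-around modulo 1 occurs.\<close>

lemma int_dev_projection:
  assumes "n \<ge> 20"
  shows "\<bar>int_dev (t n * (vec_of_complex (code s) \<bullet> u)) -
      (Re (code (sdrop (N n) s)) + Re (code s) / 10)\<bar> \<le> 1 / real (Suc n)" (is ?near)
    and "\<bar>int_dev (t n * (vec_of_complex (code s) \<bullet> u))\<bar> \<le> 24/100" (is ?small)
proof -
  let ?x = "vec_of_complex (code s)"
  let ?d = "t n *\<^sub>R u - vec_of_complex (cnj base ^ N n + 1/10)"
  define e where "e = ?x \<bullet> ?d"
  define v where "v = Re (code (sdrop (N n) s)) + Re (code s) / 10"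
  have "\<bar>e\<bar> \<le> norm ?x * norm ?d" unfolding e_def by (rule Cauchy_Schwarz_ineq2)
  also have "\<dots> \<le> 201/1000 * (1 / real (Suc n))"
    using cmod_code_le near[of n] by (intro mult_mono) auto
  finally have e: "\<bar>e\<bar> \<le> 201/1000 * (1 / real (Suc n))" .
  have "1 / real (Suc n) \<le> 1/21" using assms by (simp add: field_simps)
  then have e': "\<bar>e\<bar> \<le> 201/1000 * (1/21)" using e by linarith
  have v: "\<bar>v\<bar> \<le> 201/1000 + 201/10000"
    using abs_Re_le_cmod[of "code s"] abs_Re_le_cmod[of "code (sdrop (N n) s)"]
      cmod_code_le[of s] cmod_code_le[of "sdrop (N n) s"] unfolding v_def by linarith
  obtain a b :: int where ab: "base ^ N n * code s = code (sdrop (N n) s) + Complex (of_int a) (of_int b)"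
    using base_power_mult_code by blast
  have "t n * (?x \<bullet> u) = ?x \<bullet> vec_of_complex (cnj base ^ N n + 1/10) + e"
    by (simp add: e_def inner_diff_right)
  also have "?x \<bullet> vec_of_complex (cnj base ^ N n + 1/10) = Re (cnj (code s) * (cnj base ^ N n + 1/10))"
    by (rule inner_vec_of_complex)
  \<comment> \<open>Conjugation leaves the real part unchanged and turns \<open>cnj base\<close>
    back into \<open>base\<close>.\<close>
  also have "\<dots> = Re (cnj (cnj (code s) * (cnj base ^ N n + 1/10)))"
    by (simp only: cnj.sel)
  also have "cnj (cnj (code s) * (cnj base ^ N n + 1/10)) = base ^ N n * code s + code s / 10"
    by (simp add: algebra_simps)
  also have "Re \<dots> = of_int a + v" by (simp add: ab v_def)
  finally have "t n * (?x \<bullet> u) = of_int a + (v + e)" by simp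
  moreover have ve: "\<bar>v + e\<bar> \<le> 24/100" using v e' by linarith
  ultimately have *: "int_dev (t n * (?x \<bullet> u)) = v + e"
    by (simp add: int_dev_eq)
  have "\<bar>e\<bar> \<le> 1 / real (Suc n)" using e by (rule order_trans) (simp add: field_simps)
  then show ?near unfolding * v_def[symmetric] by simp
  show ?small unfolding * by (rule ve)
qed

lemma inner_proj_line: "proj_line u x \<bullet> u = x \<bullet> u"
  using norm_u by (simp add: proj_line_def norm_eq_1)

lemma proj_line_measurable [measurable]: "proj_line u \<in> borel_measurable borel"
  unfolding proj_line_def by measurable

text \<open>The carrier consists of the points whose phases eventually stay within 0.24 of the
  integers. Every coded point qualifies, while on the line this is a Lebesgue null set because 0.24
  < 1/4.\<close>

lemma proj_singular_stationary: "proj_singular stationary u"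
proof -
  let ?B = "{s. \<exists>m. \<forall>k\<ge>m. \<bar>int_dev (t k * s)\<bar> \<le> 24/100}"
  let ?A = "(\<lambda>x. x \<bullet> u) -` ?B"
  have B: "?B \<in> sets borel" by measurable
  have "(\<lambda>x::real^2. x \<bullet> u) \<in> borel_measurable borel" by measurable
  from measurable_sets[OF this B] have A: "?A \<in> sets borel" by simp
  have "emeasure (distr stationary borel (proj_line u)) (UNIV - ?A) =
      emeasure stationary (proj_line u -` (UNIV - ?A))"
    using A by (subst emeasure_distr) (auto cong: measurable_cong_sets)
  also have "proj_line u -` (UNIV - ?A) = UNIV - ?A"
    by (simp add: set_eq_iff inner_proj_line)
  also have "emeasure stationary (UNIV - ?A) =
      emeasure sequence_law ((\<lambda>s. vec_of_complex (code s)) -` (UNIV - ?A))"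
    unfolding stationary_def using A by (subst emeasure_distr) auto
  also have "(\<lambda>s. vec_of_complex (code s)) -` (UNIV - ?A) = {}"
    using int_dev_projection(2) by auto
  finally have 1: "emeasure (distr stationary borel (proj_line u)) (UNIV - ?A) = 0" by simp
  have "emeasure (distr lborel borel (\<lambda>r::real. r *\<^sub>R u)) ?A = emeasure lborel ((\<lambda>r. r *\<^sub>R u) -` ?A)"
    using A by (subst emeasure_distr) auto
  also have "(\<lambda>r. r *\<^sub>R u) -` ?A = ?B"
    using norm_u by (auto simp: norm_eq_1)
  also have "emeasure lborel ?B = 0"
    by (rule null_set_near_integers[OF t_at_top]) simp
  finally show ?thesis
    unfolding proj_singular_def using 1 A by blast
qed

text \<open>An inverse of the projection off a null set: the liminf equals \<open>min_Re\<close> + a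
  / 10 with \<open>a\<close> the first coordinate, and \<sigma> = a u1 + b u2 is solved for the
  second coordinate b. As \<open>int_dev\<close> is bounded, the liminf is finite and
  \<open>real_of_ereal\<close> loses nothing.\<close>

definition recover :: "real \<Rightarrow> real^2" where
  "recover \<sigma> =
    (let a = 10 * (real_of_ereal (liminf (\<lambda>n. ereal (int_dev (t n * \<sigma>)))) - min_Re)
     in vec_of_complex (of_real a + \<i> * of_real ((\<sigma> - a * u $ 1) / u $ 2)))"

lemma measurable_recover [measurable]: "recover \<in> borel_measurable borel"
  unfolding recover_def Let_def by measurable

text \<open>The real part of every code is at least \<open>min_Re\<close>, the hypothesis brings it
  arbitrarily close infinitely often, and the error 1 / (n + 1) vanishes.\<close>

lemma liminf_int_dev:
  assumes "\<forall>e>0. \<exists>\<^sub>F n in sequentially. Re (code (sdrop (N n) s)) < min_Re + e"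
  shows "liminf (\<lambda>n. ereal (int_dev (t n * (vec_of_complex (code s) \<bullet> u)))) =
    ereal (min_Re + Re (code s) / 10)"
proof (rule antisym)
  let ?f = "\<lambda>n. int_dev (t n * (vec_of_complex (code s) \<bullet> u))"
  let ?l = "min_Re + Re (code s) / 10"
  have ev: "eventually (\<lambda>n. n \<ge> 20 \<and> 1 / real (Suc n) < e) sequentially" if "e > 0" for e
    using order_tendstoD(2)[OF LIMSEQ_inverse_real_of_nat that] eventually_ge_at_top[of 20]
    by eventually_elim (simp add: inverse_eq_divide)
  show "liminf (\<lambda>n. ereal (?f n)) \<le> ereal ?l"
  proof (rule ereal_le_epsilon2)
    fix e :: real assume e: "e > 0"
    have "\<exists>\<^sub>F n in sequentially. ereal (?f n) \<le> ereal (?l + e)"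
    proof (rule frequently_rev_mp[OF _ eventually_mono[OF ev[of "e/2"]]])
      show "\<exists>\<^sub>F n in sequentially. Re (code (sdrop (N n) s)) < min_Re + e/2"
        using assms e by auto
      show "Re (code (sdrop (N n) s)) < min_Re + e/2 \<longrightarrow> ereal (?f n) \<le> ereal (?l + e)"
        if "n \<ge> 20 \<and> 1 / real (Suc n) < e/2" for n
        using int_dev_projection(1)[of n s] that by auto
    qed (use e in simp)
    then have "liminf (\<lambda>n. ereal (?f n)) \<le> ereal (?l + e)"
      using less_LiminfD[of "ereal (?l + e)" sequentially "\<lambda>n. ereal (?f n)"]
      unfolding frequently_def not_le by (meson not_le)
    then show "liminf (\<lambda>n. ereal (?f n)) \<le> ereal ?l + ereal e" by simp
  qed
  show "ereal ?l \<le> liminf (\<lambda>n. ereal (?f n))"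
  proof (rule ereal_le_epsilon2)
    fix e :: real assume e: "e > 0"
    have "eventually (\<lambda>n. ereal (?l - e) \<le> ereal (?f n)) sequentially"
    proof (rule eventually_mono[OF ev[OF e]])
      fix n assume n: "n \<ge> 20 \<and> 1 / real (Suc n) < e"
      have "min_Re \<le> Re (code (sdrop (N n) s))"
        unfolding min_Re_def by (rule cINF_lower[OF bdd_below_Re_code]) simp
      then show "ereal (?l - e) \<le> ereal (?f n)"
        using int_dev_projection(1)[of n s] n by auto
    qed
    then have "ereal (?l - e) \<le> liminf (\<lambda>n. ereal (?f n))"
      by (rule Liminf_bounded)
    then show "ereal ?l \<le> liminf (\<lambda>n. ereal (?f n)) + ereal e"
      by (cases "liminf (\<lambda>n. ereal (?f n))") auto
  qed
qed

lemma AE_recover: "AE x in stationary. recover (x \<bullet> u) = x"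
proof -
  have "AE s in sequence_law. recover (vec_of_complex (code s) \<bullet> u) = vec_of_complex (code s)"
    using AE_frequently_near_min_Re[OF N_at_top]
  proof eventually_elim
    case (elim s)
    have "vec_of_complex (code s) \<bullet> u = Re (code s) * u $ 1 + Im (code s) * u $ 2"
      by (simp add: inner_vec_def UNIV_2)
    moreover have "recover (vec_of_complex (code s) \<bullet> u) = vec_of_complex (of_real (Re (code s)) +
        \<i> * of_real ((vec_of_complex (code s) \<bullet> u - Re (code s) * u $ 1) / u $ 2))"
      unfolding recover_def liminf_int_dev[OF elim] by (simp add: Let_def)
    ultimately show ?case
      using u2 by (simp add: vec2_eq_iff)
  qed
  moreover have "{x \<in> space borel. recover (x \<bullet> u) = x} \<in> sets borel"
    by measurable
  ultimately show ?thesis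
    unfolding stationary_def by (subst AE_distr_iff) auto
qed

text \<open>Since a point is almost surely a Borel function of its projection, every bounded Borel
  \<open>f\<close> agrees almost everywhere with a function measurable for the projection algebra.
  Its conditional expectation is then \<open>f\<close> itself, the integral against a Dirac
  mass.\<close>

lemma disintegration_return: "disintegration stationary u (return borel)"
  unfolding disintegration_def
proof (intro conjI allI impI)
  fix x :: "real^2"
  show "prob_space (return borel x)" by (rule prob_space_return) simp
  show "sets (return borel x) = sets borel" by simp
  have "proj_line u -` {proj_line u x} \<in> sets borel"
    using measurable_sets[OF proj_line_measurable, of "{proj_line u x}"] by simp
  then have "UNIV - proj_line u -` {proj_line u x} \<in> sets borel" by (metis sets.compl_sets space_borel)
  then show "emeasure (return borel x) (UNIV - proj_line u -` {proj_line u x}) = 0"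
    by simp
next
  fix f :: "real^2 \<Rightarrow> real" assume f: "f \<in> borel_measurable borel \<and> bounded (range f)"
  then have [measurable]: "f \<in> borel_measurable borel" by simp
  let ?F = "vimage_algebra UNIV (proj_line u) borel"
  interpret prob_space stationary by (rule prob_space_stationary)
  have sub: "subalgebra stationary ?F"
    unfolding subalgebra_def
  proof
    show "sets ?F \<subseteq> sets stationary"
      using measurable_sets[OF proj_line_measurable] by (auto simp: sets_vimage_algebra2)
  qed simp
  interpret finite_measure_subalgebra stationary ?F by standard (rule sub)
  let ?g = "\<lambda>x. f (recover (x \<bullet> u))"
  have fS: "f \<in> borel_measurable stationary" "?g \<in> borel_measurable stationary"
    by (auto simp: measurable_cong_sets[OF sets_stationary refl])
  \<comment> \<open>Written through \<open>proj_line u x\<close>, the function is visibly measurable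
    for the pulled-back algebra; the inner product with \<open>u\<close> is unchanged by the
    projection.\<close>
  have "(\<lambda>x. f (recover (proj_line u x \<bullet> u))) \<in> borel_measurable ?F"
    by (rule measurable_compose[OF measurable_vimage_algebra1]) auto
  then have gF: "?g \<in> borel_measurable ?F" by (simp only: inner_proj_line)
  obtain B where "\<And>x. norm (f x) \<le> B" using f by (auto simp: bounded_iff)
  then have "integrable stationary ?g"
    using fS by (intro integrable_const_bound[where B = B]) auto
  from real_cond_exp_F_meas[OF this gF]
  have 1: "AE x in stationary. real_cond_exp stationary ?F ?g x = ?g x" .
  have eq: "AE x in stationary. f x = ?g x"
    using AE_recover by eventually_elim simp
  have "AE x in stationary. real_cond_exp stationary ?F f x = real_cond_exp stationary ?F ?g x"
    by (rule real_cond_exp_cong[OF eq fS])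
  with 1 eq show "AE x in stationary. (\<integral>y. f y \<partial>(return borel x)) = real_cond_exp stationary ?F f x"
    by eventually_elim (simp add: integral_return)
qed

end

section \<open>Generic directions lie in both sets of the theorem\<close>

lemma discrete_measure_return: "discrete_measure (return borel (x::real^2))"
  unfolding discrete_measure_def by (intro exI[of _ "{x}"]) simp

theorem theorem1p1:
  shows "\<exists>(r::real) (R::real^2^2) (I::nat set) (a::nat \<Rightarrow> real^2).
    0 < r \<and> r < 1 \<and> rotation_matrix R \<and> (\<forall>n::nat. n \<ge> 1 \<longrightarrow> ((\<lambda>x. R *v x) ^^ n) \<noteq> id) \<and>
    finite I \<and> I \<noteq> {} \<and> SSC r R I a \<and>
    (\<exists>\<mu>. self_similar_measure r R I a \<mu> \<and>
       (\<exists>d>1. exact_dim \<mu> d) \<and>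
       contains_dense_Gdelta (sphere 0 1) {u \<in> sphere 0 1. proj_singular \<mu> u} \<and>
       contains_dense_Gdelta (sphere 0 1)
         {u \<in> sphere 0 1. \<exists>\<nu>. disintegration \<mu> u \<nu> \<and> (AE x in \<mu>. discrete_measure (\<nu> x))})"
proof (rule exI[of _ ratio], rule exI[of _ rot], rule exI[of _ "{..<9}"], rule exI[of _ shift_vec],
    intro conjI exI[of _ stationary] exI[of _ similarity_dim] allI impI)
  have sphere: "u \<in> sphere 0 1" if "u \<in> generic_directions" for u
    using that by (auto simp: generic_directions_def near_frequency_def)
  show "contains_dense_Gdelta (sphere 0 1) {u \<in> sphere 0 1. proj_singular stationary u}"
  proof (intro contains_dense_Gdelta_if_generic subsetI CollectI conjI)
    fix u assume u: "u \<in> generic_directions"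
    show "u \<in> sphere 0 1" using u by (rule sphere)
    obtain t N where "generic_direction u t N" using u by (rule generic_directionsE)
    then show "proj_singular stationary u" by (rule generic_direction.proj_singular_stationary)
  qed
  show "contains_dense_Gdelta (sphere 0 1) {u \<in> sphere 0 1. \<exists>\<nu>. disintegration stationary u \<nu> \<and>
      (AE x in stationary. discrete_measure (\<nu> x))}"
  proof (intro contains_dense_Gdelta_if_generic subsetI CollectI conjI exI[of _ "return borel"])
    fix u assume u: "u \<in> generic_directions"
    show "u \<in> sphere 0 1" using u by (rule sphere)
    obtain t N where "generic_direction u t N" using u by (rule generic_directionsE)
    then show "disintegration stationary u (return borel)" by (rule generic_direction.disintegration_return)
    show "AE x in stationary. discrete_measure (return borel x)" by (simp add: discrete_measure_return)
  qed
qed (simp_all add: ratio_pos ratio_less_1 rotation_matrix_rot rot_power_neq_id SSC_ifs lessThan_empty_iff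
    self_similar_measure_stationary similarity_dim_gt_1 exact_dim_stationary)

end
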